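(* Let $p\in(0,1)$, $q=1-p$, and for $N\ge1$ let $\{\xi_{i,j}(s):1\le i,j\le N,s\ge1\}$ be i.i.d. Bernoulli with $\mathbb P(\xi=1)=p$, $\mathbb P(\xi=0)=q$. Let $X(0)\in\mathbb R^N$ and $X_i(t+1)=\max_{1\le j\le N}\{X_j(t)+\xi_{i,j}(t+1)\}$, and let $v_N=\lim_{t\to\infty}t^{-1}\max_{i\le N}X_i(t)$ (this limit exists a.s. and is deterministic). Then, as $N\to\infty$, $$v_N=1-q^{N^2}2^N+o(q^{N^2}2^N).$$ *)

theory Defs
  imports "HOL-Probability.Probability" "HOL-Library.Landau_Symbols"
begin

definition xi_index :: "nat \<Rightarrow> (nat \<times> nat \<times> nat) set" where
  "xi_index N = {1..N} \<times> {1..N} \<times> {1..}"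

text \<open>Probability space: i.i.d. Bernoulli(p) variables indexed by xi_index N;
  an outcome omega assigns to (i,j,s) the value of xi_{i,j}(s) (True = 1).\<close>
definition xi_space :: "real \<Rightarrow> nat \<Rightarrow> ((nat \<times> nat \<times> nat) \<Rightarrow> bool) measure" where
  "xi_space p N = PiM (xi_index N) (\<lambda>_. measure_pmf (bernoulli_pmf p))"

text \<open>The max-plus process X(t) with initial condition X0 (only X0 on {1..N} matters).\<close>
fun Xproc :: "nat \<Rightarrow> (nat \<Rightarrow> real) \<Rightarrow> ((nat \<times> nat \<times> nat) \<Rightarrow> bool) \<Rightarrow> nat \<Rightarrow> nat \<Rightarrow> real" where
  "Xproc N X0 \<omega> 0 i = X0 i"
| "Xproc N X0 \<omega> (Suc t) i =
     Max ((\<lambda>j. Xproc N X0 \<omega> t j + (if \<omega> (i, j, Suc t) then 1 else 0)) ` {1..N})"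

end

theory Submission
  imports Defs "HOL-Real_Asymp.Real_Asymp" "HOL-Library.Discrete_Functions"
begin

text \<open>Started from 0, all coordinates equal the maximum or the maximum minus 1, and the number
  \<open>k\<close> of coordinates at the maximum (the front) is a Markov chain: the next value is binomial with
  parameters \<open>N\<close> and \<open>1 - q^k\<close>, except that the outcome 0, of probability \<open>q^(k * N)\<close>, is a stall of
  the maximum and resets the front to everything. Stall counts are additive over time windows up
  to an error of 1 per window, so Hoeffding's inequality for \<open>k\<close> windows of length \<open>k\<close> and
  Borel-Cantelli give an almost sure stall rate \<open>f\<close>, and \<open>v = 1 - f\<close>.

  The chain sits at \<open>k = N\<close> most of the time. Before returning there it stalls, in leading order, with
  probability \<open>q^(N * N) * 2^N\<close>: choosing the \<open>m\<close> hit coordinates and then stalling from \<open>m\<close> costs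
  \<open>q^(N * (N - m)) * q^(m * N)\<close> whatever \<open>m\<close> is. Test functions close to \<open>q^(k * N)\<close> turn this into
  two-sided bounds on \<open>f\<close>.\<close>

section \<open>Binomial sums\<close>

text \<open>No stationary law of the front chain is computed. A nonnegative function
  \<open>u\<close> of the front size whose drift, stalls included, is at most \<open>w\<close> per
  step telescopes to \<open>mean_stalls n \<le> n * w + u N\<close>; reversed inequalities give the
  lower bound. So \<open>f\<close> is bracketed by explicit super- and subsolutions of a Poisson
  equation with \<open>u N = 0\<close>. The obstacle is the upper bound: from \<open>k < N\<close>
  the chain may pass through many front sizes before it stalls or fills up, and the supersolution
  must dominate all these routes for every \<open>k\<close> at once. In terms of
  \<open>j = N - k\<close> this is the inequality of \<open>eventually_sum_choose_excess_le\<close>,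
  which is why binomial sums come before any probability. They are cut at distance
  \<open>L = floor_sqrt N\<close> from \<open>N\<close>: the near indices cost about
  \<open>N ^ L\<close> against an exponentially small factor, so \<open>L * ln N\<close> must be
  o(N); the far ones need \<open>N * q ^ L\<close> to vanish, so \<open>L\<close> must outgrow
  \<open>ln N\<close>. The square root does both. There are as many windows as their length because
  \<open>k\<close> junction errors are negligible against time \<open>k * k\<close>, while
  \<open>k\<close> independent windows still give a deviation bound exponential in
  \<open>k\<close>.\<close>

definition excess :: "real \<Rightarrow> nat \<Rightarrow> nat \<Rightarrow> real" where
  "excess q N i = (1 + q ^ i) ^ N - 1"

lemma excess_nonneg: "0 \<le> q \<Longrightarrow> 0 \<le> excess q N i"
  by (simp add: excess_def)

lemma excess_antimono:
  assumes "0 \<le> q" "q \<le> 1" "i \<le> j"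
  shows "excess q N j \<le> excess q N i"
  using assms by (auto simp: excess_def intro!: power_mono power_decreasing)

text \<open>Thus the excess is the total weight of the nonempty subsets of \<open>N\<close> points
  when each point weighs \<open>q ^ j\<close>. The exponent \<open>j\<close> will be the number of
  coordinates missing from the front.\<close>

lemma excess_eq_sum: "excess q N j = (\<Sum>m=1..N. real (N choose m) * (q ^ j) ^ m)"
proof -
  have "(1 + q ^ j) ^ N = (\<Sum>m=0..N. real (N choose m) * (q ^ j) ^ m)"
    using binomial_ring[of "q ^ j" 1 N] by (simp add: add.commute atMost_atLeast0)
  also have "\<dots> = 1 + (\<Sum>m=1..N. real (N choose m) * (q ^ j) ^ m)"
    by (simp add: sum.atLeast_Suc_atMost)
  finally show ?thesis by (simp add: excess_def)
qed

text \<open>The power of \<open>1 + q ^ j\<close> is kept because later errors must be small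
  relative to \<open>excess q N j\<close>, which is exponentially large in \<open>N\<close> for
  fixed \<open>j\<close>.\<close>

lemma excess_lower:
  assumes "0 \<le> q" "1 \<le> N"
  shows "q ^ j * (1 + q ^ j) ^ (N - 1) \<le> excess q N j"
proof -
  obtain M where M: "N = Suc M" using assms(2) by (cases N) auto
  have "1 \<le> (1 + q ^ j) ^ M" using assms(1) by simp
  then show ?thesis by (simp add: M excess_def algebra_simps)
qed

lemma sum_reflect:
  fixes f :: "nat \<Rightarrow> 'a::comm_monoid_add"
  shows "(\<Sum>m=1..<N. f m) = (\<Sum>i=1..<N. f (N - i))"
  by (rule sum.reindex_bij_witness[where i="\<lambda>i. N - i" and j="\<lambda>i. N - i"]) auto

text \<open>The indices within \<^term>\<open>L\<close> of \<^term>\<open>N\<close> are few, and for the others the excess is small.\<close>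

lemma sum_choose_excess_le:
  assumes q: "0 \<le> q" "q \<le> 1" and x: "0 \<le> x" "x \<le> 1" and N: "1 \<le> N"
  shows "(\<Sum>m=1..<N. real (N choose m) * x ^ m * excess q N (N - m))
    \<le> real L * real N ^ L * (x ^ (N - L) * (1 + q) ^ N)
      + excess q N (Suc L) * (\<Sum>m=1..N. real (N choose m) * x ^ m)"
proof -
  define c where "c = x ^ (N - L) * (1 + q) ^ N"
  have c: "0 \<le> c" using q x by (simp add: c_def)
  have point: "real (N choose m) * x ^ m * excess q N (N - m)
      \<le> (if N - m \<le> L then real (N choose m) * c else 0)
        + excess q N (Suc L) * (real (N choose m) * x ^ m)" if m: "m \<in> {1..<N}" for m
  proof (cases "N - m \<le> L")
    case True
    have "x ^ m \<le> x ^ (N - L)" using True x by (intro power_decreasing) auto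
    moreover have "excess q N (N - m) \<le> (1 + q) ^ N"
    proof -
      have "q ^ (N - m) \<le> q ^ 1" using q m by (intro power_decreasing) auto
      then have "(1 + q ^ (N - m)) ^ N \<le> (1 + q) ^ N" using q by (intro power_mono) auto
      then show ?thesis by (simp add: excess_def)
    qed
    ultimately have "x ^ m * excess q N (N - m) \<le> c"
      unfolding c_def using x excess_nonneg[OF q(1)] by (intro mult_mono) auto
    then have "real (N choose m) * (x ^ m * excess q N (N - m)) \<le> real (N choose m) * c"
      by (intro mult_left_mono) auto
    moreover have "0 \<le> excess q N (Suc L) * (real (N choose m) * x ^ m)"
      using x excess_nonneg[OF q(1)] by simp
    ultimately show ?thesis using True by (simp add: mult.assoc)
  next
    case False
    then have "excess q N (N - m) \<le> excess q N (Suc L)"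
      using q by (intro excess_antimono) auto
    then have "real (N choose m) * x ^ m * excess q N (N - m)
        \<le> real (N choose m) * x ^ m * excess q N (Suc L)"
      using x by (intro mult_left_mono) auto
    with False show ?thesis by (simp add: mult_ac)
  qed
  \<comment> \<open>Reflecting \<open>m\<close> to \<open>N - m\<close> moves the near indices to
    \<open>i \<le> L\<close>, where \<open>N choose i\<close> is at most
    \<open>N ^ L\<close>.\<close>
  have "(\<Sum>m=1..<N. if N - m \<le> L then real (N choose m) * c else 0)
      = (\<Sum>i=1..<N. if i \<le> L then real (N choose i) * c else 0)"
    by (subst sum_reflect) (auto intro!: sum.cong simp: binomial_symmetric[symmetric])
  also have "\<dots> \<le> (\<Sum>i\<in>{1..<N} \<inter> {1..L}. real (N choose i) * c)"
    by (subst sum.inter_restrict) (auto intro!: sum_mono)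
  also have "\<dots> \<le> (\<Sum>i=1..L. real (N choose i) * c)"
    using c by (intro sum_mono2) auto
  also have "\<dots> \<le> (\<Sum>i=1..L. real N ^ L * c)"
  proof (intro sum_mono mult_right_mono c)
    fix i assume i: "i \<in> {1..L}"
    have "N choose i \<le> N ^ i"
      by (cases "i \<le> N") (auto simp: binomial_le_pow binomial_eq_0)
    then have "real (N choose i) \<le> real N ^ i"
      by (metis of_nat_mono of_nat_power)
    also have "\<dots> \<le> real N ^ L"
      using i N by (intro power_increasing) auto
    finally show "real (N choose i) \<le> real N ^ L" .
  qed
  finally have *: "(\<Sum>m=1..<N. if N - m \<le> L then real (N choose m) * c else 0)
      \<le> real L * real N ^ L * c" by simp
  have "(\<Sum>m=1..<N. real (N choose m) * x ^ m * excess q N (N - m))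
      \<le> (\<Sum>m=1..<N. (if N - m \<le> L then real (N choose m) * c else 0)
        + excess q N (Suc L) * (real (N choose m) * x ^ m))"
    by (intro sum_mono point)
  also have "\<dots> \<le> real L * real N ^ L * c
      + excess q N (Suc L) * (\<Sum>m=1..<N. real (N choose m) * x ^ m)"
    using * by (simp add: sum.distrib sum_distrib_left)
  also have "\<dots> \<le> real L * real N ^ L * c
      + excess q N (Suc L) * (\<Sum>m=1..N. real (N choose m) * x ^ m)"
    using x excess_nonneg[OF q(1)]
    by (intro add_left_mono mult_left_mono sum_mono2) auto
  finally show ?thesis by (simp add: c_def)
qed

lemma floor_sqrt_le_sqrt: "real (floor_sqrt n) \<le> sqrt (real n)"
proof -
  have "(real (floor_sqrt n))\<^sup>2 \<le> real n"
    using floor_sqrt_power2_le[of n] by (metis of_nat_mono of_nat_power)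
  then show ?thesis by (rule real_le_rsqrt)
qed

lemma sqrt_le_Suc_floor_sqrt: "sqrt (real n) \<le> real (Suc (floor_sqrt n))"
proof -
  have "real n \<le> (real (Suc (floor_sqrt n)))\<^sup>2"
    using Suc_floor_sqrt_power2_gt[of n] by (metis less_imp_le of_nat_mono of_nat_power)
  then show ?thesis by (intro real_le_lsqrt) auto
qed

section \<open>Asymptotics of the sums cut at \<open>floor_sqrt N\<close>\<close>

context
  fixes q :: real
  assumes q: "0 < q" "q < 1"
begin

text \<open>The prefactors are of size exp(O(sqrt(N) * ln N)) and lose against exponential decay in
  \<open>N\<close>. The limit is used with \<open>r = (1 + q) / 2\<close> and with
  \<open>r = q\<close>.\<close>

lemma tendsto_floor_sqrt_power:
  assumes r: "0 < r" "r < 1"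
  shows "(\<lambda>N. real (floor_sqrt N) * real N ^ floor_sqrt N * 2 ^ Suc (floor_sqrt N)
    * r ^ (N - Suc (floor_sqrt N))) \<longlonglongrightarrow> 0"
proof (rule tendsto_sandwich[OF _ _ tendsto_const])
  define c where "c = - ln r"
  have c: "0 < c" "r = exp (- c)" using r by (auto simp: c_def)
  show "(\<lambda>N. sqrt (real N) * real N powr sqrt (real N) * (2 * 2 powr sqrt (real N))
      * exp (- c * (real N - sqrt (real N) - 1))) \<longlonglongrightarrow> 0"
    using c(1) by real_asymp
  show "\<forall>\<^sub>F N in sequentially. real (floor_sqrt N) * real N ^ floor_sqrt N * 2 ^ Suc (floor_sqrt N)
    * r ^ (N - Suc (floor_sqrt N)) \<le> sqrt (real N) * real N powr sqrt (real N)
      * (2 * 2 powr sqrt (real N)) * exp (- c * (real N - sqrt (real N) - 1))"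
    \<comment> \<open>From 4 on, \<open>2 \<le> ?L\<close>, hence
      \<open>Suc ?L \<le> 2 * ?L \<le> ?L * ?L \<le> N\<close>, and the natural subtraction in the
      exponent does not truncate.\<close>
    using eventually_ge_at_top[of 4]
  proof eventually_elim
    case (elim N)
    let ?L = "floor_sqrt N"
    note L = floor_sqrt_le_sqrt[of N]
    have "Suc ?L \<le> N"
    proof -
      have "2 \<le> ?L" using elim by (simp add: le_floor_sqrt_iff)
      then have "2 * ?L \<le> ?L\<^sup>2" by (simp add: power2_eq_square)
      with \<open>2 \<le> ?L\<close> floor_sqrt_power2_le[of N] show ?thesis by linarith
    qed
    then have "r ^ (N - Suc ?L) = exp (- c * (real N - real ?L - 1))"
      by (simp add: c(2) exp_of_nat_mult[symmetric] of_nat_diff algebra_simps)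
    also have "\<dots> \<le> exp (- c * (real N - sqrt (real N) - 1))"
      using L c(1) by simp
    finally have 1: "r ^ (N - Suc ?L) \<le> exp (- c * (real N - sqrt (real N) - 1))" .
    have 2: "real N ^ ?L \<le> real N powr sqrt (real N)"
      using L elim by (simp add: powr_realpow[symmetric] powr_mono)
    have 3: "2 ^ Suc ?L \<le> 2 * 2 powr sqrt (real N)"
      using L by (simp add: powr_realpow[symmetric] powr_mono)
    show ?case
      using r by (intro mult_mono L 1 2 3) auto
  qed
qed (use r in auto)

text \<open>The excess is at most \<open>exp (N * q ^ Suc L) - 1\<close>, and
  \<open>q ^ sqrt N\<close> beats the factor \<open>N\<close>.\<close>

lemma excess_floor_sqrt_tendsto_0: "(\<lambda>N. excess q N (Suc (floor_sqrt N))) \<longlonglongrightarrow> 0"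
proof (rule tendsto_sandwich[OF _ _ tendsto_const])
  define c where "c = - ln q"
  have c: "0 < c" "q = exp (- c)" using q by (auto simp: c_def)
  show "(\<lambda>N. (1 + exp (- c * sqrt (real N))) powr real N - 1) \<longlonglongrightarrow> 0"
    using c(1) by real_asymp
  have "excess q N (Suc (floor_sqrt N)) \<le> (1 + exp (- c * sqrt (real N))) powr real N - 1" for N
  proof -
    have "q ^ Suc (floor_sqrt N) = exp (- c * real (Suc (floor_sqrt N)))"
      by (simp only: c(2) exp_of_nat_mult[symmetric] mult.commute)
    also have "\<dots> \<le> exp (- c * sqrt (real N))"
      using c(1) sqrt_le_Suc_floor_sqrt[of N] by simp
    finally have "(1 + q ^ Suc (floor_sqrt N)) ^ N \<le> (1 + exp (- c * sqrt (real N))) ^ N"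
      using q by (intro power_mono) auto
    then show ?thesis
      by (subst powr_realpow) (auto simp: excess_def add_pos_pos)
  qed
  then show "\<forall>\<^sub>F N in sequentially. excess q N (Suc (floor_sqrt N))
      \<le> (1 + exp (- c * sqrt (real N))) powr real N - 1" by simp
  show "\<forall>\<^sub>F N in sequentially. 0 \<le> excess q N (Suc (floor_sqrt N))"
    using q by (simp add: excess_nonneg)
qed

text \<open>Up to its end terms this is the mean of the excess over a uniformly random subset of
  size \<open>m\<close>. The excess is large only for \<open>m\<close> near \<open>N\<close>, where
  it is at most \<open>(1 + q) ^ N\<close> and there are too few subsets to compete with
  \<open>2 ^ N\<close>. It will be the relative error of the upper bound on the stall rate.\<close>

lemma sum_choose_excess_tendsto_0:
  "(\<lambda>N. (\<Sum>m=1..<N. real (N choose m) * excess q N (N - m)) / 2 ^ N) \<longlonglongrightarrow> 0"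
proof (rule tendsto_sandwich[OF _ _ tendsto_const])
  define r where "r = (1 + q) / 2"
  have r: "0 < r" "r < 1" using q by (auto simp: r_def)
  let ?L = floor_sqrt
  let ?u = "\<lambda>N. real (?L N) * real N ^ ?L N * 2 ^ Suc (?L N) * r ^ (N - Suc (?L N))
    + excess q N (Suc (?L N))"
  show "?u \<longlonglongrightarrow> 0"
    using tendsto_add[OF tendsto_floor_sqrt_power[OF r] excess_floor_sqrt_tendsto_0] by simp
  show "\<forall>\<^sub>F N in sequentially. 0 \<le> (\<Sum>m=1..<N. real (N choose m) * excess q N (N - m)) / 2 ^ N"
    using q by (simp add: sum_nonneg excess_nonneg)
  show "\<forall>\<^sub>F N in sequentially. (\<Sum>m=1..<N. real (N choose m) * excess q N (N - m)) / 2 ^ N \<le> ?u N"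
    using eventually_ge_at_top[of 1]
  proof eventually_elim
    case (elim N)
    have "(\<Sum>m=1..<N. real (N choose m) * excess q N (N - m))
      \<le> real (?L N) * real N ^ ?L N * (1 + q) ^ N
        + excess q N (Suc (?L N)) * (\<Sum>m=1..N. real (N choose m))"
      using sum_choose_excess_le[of q 1 N "?L N"] q elim by simp
    also have "\<dots> \<le> real (?L N) * real N ^ ?L N * (1 + q) ^ N + excess q N (Suc (?L N)) * 2 ^ N"
    proof (intro add_left_mono mult_left_mono)
      have "(\<Sum>m=1..N. real (N choose m)) \<le> (\<Sum>m=0..N. real (N choose m))"
        by (intro sum_mono2) auto
      also have "\<dots> = 2 ^ N"
        using choose_row_sum[of N] by (metis atMost_atLeast0 of_nat_numeral of_nat_power of_nat_sum)
      finally show "(\<Sum>m=1..N. real (N choose m)) \<le> 2 ^ N" .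
    qed (use q in \<open>simp add: excess_nonneg\<close>)
    finally have "(\<Sum>m=1..<N. real (N choose m) * excess q N (N - m)) / 2 ^ N
        \<le> real (?L N) * real N ^ ?L N * r ^ N + excess q N (Suc (?L N))"
      by (simp add: field_simps r_def)
    also have "\<dots> \<le> ?u N"
    proof (intro add_right_mono)
      have "r ^ N \<le> 1 * r ^ (N - Suc (?L N))"
        using r by (simp add: power_decreasing)
      also have "\<dots> \<le> 2 ^ Suc (?L N) * r ^ (N - Suc (?L N))"
        using r by (intro mult_right_mono one_le_power) auto
      finally show "real (?L N) * real N ^ ?L N * r ^ N
          \<le> real (?L N) * real N ^ ?L N * 2 ^ Suc (?L N) * r ^ (N - Suc (?L N))"
        by (simp add: mult.assoc mult_left_mono)
    qed
    finally show ?case .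
  qed
qed

text \<open>This makes the test function of \<open>mean_stalls_le\<close> a supersolution;
  uniformity in \<open>j\<close> is essential. The budget is two excesses: the undoubled part of the
  sum takes one, the near and far parts take a quarter each, and doubling those two makes the
  second.\<close>

lemma eventually_sum_choose_excess_le:
  "\<forall>\<^sub>F N in sequentially. \<forall>j. 1 \<le> j \<longrightarrow>
    (\<Sum>m=1..<N. real (N choose m) * (q ^ j) ^ m * (1 + 2 * excess q N (N - m))) \<le> 2 * excess q N j"
proof -
  let ?L = floor_sqrt
  let ?a = "\<lambda>N. real (?L N) * real N ^ ?L N * 2 ^ Suc (?L N) * q ^ (N - Suc (?L N))"
  have "\<forall>\<^sub>F N in sequentially. ?a N < 1 / 4"
    by (rule order_tendstoD[OF tendsto_floor_sqrt_power[OF q]]) simp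
  moreover have "\<forall>\<^sub>F N in sequentially. excess q N (Suc (?L N)) < 1 / 4"
    by (rule order_tendstoD[OF excess_floor_sqrt_tendsto_0]) simp
  ultimately show ?thesis
    using eventually_ge_at_top[of 4]
  proof eventually_elim
    case (elim N)
    define L where "L = ?L N"
    have LN: "Suc L \<le> N"
    proof -
      have "2 \<le> L" using elim by (simp add: le_floor_sqrt_iff L_def)
      then have "2 * L \<le> L\<^sup>2" by (simp add: power2_eq_square)
      with \<open>2 \<le> L\<close> floor_sqrt_power2_le[of N] show ?thesis unfolding L_def by linarith
    qed
    show ?case
    proof (intro allI impI)
      fix j :: nat assume j: "1 \<le> j"
      define x where "x = q ^ j"
      have x: "0 < x" "x \<le> q"
        using q j power_decreasing[of 1 j q] by (auto simp: x_def)
      have D0: "0 \<le> excess q N j" using q by (simp add: excess_nonneg)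
      obtain M where M: "N = M + Suc L" using LN by (metis add.commute le_Suc_ex)
      have "x ^ (N - L) * (1 + q) ^ N = x * ((1 + q) * x) ^ M * (1 + q) ^ Suc L"
        by (simp add: M power_add power_mult_distrib mult_ac)
      also have "\<dots> \<le> x * (q * (1 + x)) ^ M * 2 ^ Suc L"
      proof -
        \<comment> \<open>This is where \<open>x \<le> q\<close> enters: \<open>q ^ M\<close> is
          left to pay for \<open>N ^ L\<close>, while \<open>(1 + x) ^ M\<close> is absorbed by the
          excess through \<open>excess_lower\<close>.\<close>
        have "(1 + q) * x \<le> q * (1 + x)" using x by (simp add: algebra_simps)
        then have "((1 + q) * x) ^ M \<le> (q * (1 + x)) ^ M"
          using x q by (intro power_mono) auto
        moreover have "(1 + q) ^ Suc L \<le> 2 ^ Suc L"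
          using q by (intro power_mono) auto
        ultimately show ?thesis
          using x q by (intro mult_mono[of "_ * _ ^ _"] mult_left_mono) auto
      qed
      also have "\<dots> = 2 ^ Suc L * q ^ (N - Suc L) * (x * (1 + x) ^ M)"
        by (simp add: M power_mult_distrib mult_ac)
      also have "\<dots> \<le> 2 ^ Suc L * q ^ (N - Suc L) * excess q N j"
      proof (rule mult_left_mono)
        have "x * (1 + x) ^ M \<le> x * (1 + x) ^ (N - 1)"
          using x by (intro mult_left_mono power_increasing) (auto simp: M)
        also have "\<dots> \<le> excess q N j"
          unfolding x_def using q LN by (intro excess_lower) auto
        finally show "x * (1 + x) ^ M \<le> excess q N j" .
      qed (use q in auto)
      finally have "real L * real N ^ L * (x ^ (N - L) * (1 + q) ^ N)
          \<le> real L * real N ^ L * (2 ^ Suc L * q ^ (N - Suc L) * excess q N j)"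
        by (rule mult_left_mono) simp
      also have "\<dots> = ?a N * excess q N j"
        by (simp add: L_def mult_ac)
      also have "\<dots> \<le> 1 / 4 * excess q N j"
        using elim D0 by (intro mult_right_mono) auto
      finally have near: "real L * real N ^ L * (x ^ (N - L) * (1 + q) ^ N) \<le> excess q N j / 4"
        by simp
      have far: "excess q N (Suc L) * excess q N j \<le> 1 / 4 * excess q N j"
        using elim D0 by (intro mult_right_mono) (auto simp: L_def)
      have "(\<Sum>m=1..<N. real (N choose m) * x ^ m * (1 + 2 * excess q N (N - m)))
        = (\<Sum>m=1..<N. real (N choose m) * x ^ m)
          + 2 * (\<Sum>m=1..<N. real (N choose m) * x ^ m * excess q N (N - m))"
        by (simp add: sum.distrib sum_distrib_left algebra_simps)
      also have "(\<Sum>m=1..<N. real (N choose m) * x ^ m) \<le> excess q N j"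
        unfolding excess_eq_sum x_def[symmetric] using x by (intro sum_mono2) auto
      also have "(\<Sum>m=1..<N. real (N choose m) * x ^ m * excess q N (N - m))
        \<le> real L * real N ^ L * (x ^ (N - L) * (1 + q) ^ N) + excess q N (Suc L) * excess q N j"
        unfolding excess_eq_sum[of q N j] x_def[symmetric]
        using q x elim by (intro sum_choose_excess_le) auto
      finally show "(\<Sum>m=1..<N. real (N choose m) * (q ^ j) ^ m * (1 + 2 * excess q N (N - m)))
          \<le> 2 * excess q N j"
        using near far by (simp add: x_def)
    qed
  qed
qed

end

section \<open>Nearly additive sequences\<close>

text \<open>Cutting a length \<open>k * n\<close> into \<open>k\<close> pieces costs about
  \<open>k * C\<close>, so the rates at \<open>n\<close> and \<open>k * n\<close> differ by O(1/n).
  The rates at \<open>m\<close> and \<open>n\<close> are then compared through the common multiple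
  \<open>n * m\<close>.\<close>

lemma near_additive_convergent:
  fixes a :: "nat \<Rightarrow> real"
  assumes "\<And>m n. \<bar>a (m + n) - a m - a n\<bar> \<le> C"
  shows "convergent (\<lambda>n. a n / real n)"
proof -
  have C: "0 \<le> C" using assms[of 0 0] by linarith
  \<comment> \<open>The extra 1 covers \<open>k = 0\<close>, where the claim is
    \<open>\<bar>a 0\<bar> \<le> C\<close>.\<close>
  have mult: "\<bar>a (k * n) - real k * a n\<bar> \<le> (real k + 1) * C" for k n
  proof (induction k)
    case 0
    then show ?case using assms[of 0 0] by simp
  next
    case (Suc k)
    have "a (Suc k * n) - real (Suc k) * a n
        = (a (n + k * n) - a n - a (k * n)) + (a (k * n) - real k * a n)"
      by (simp add: algebra_simps)
    then show ?case using Suc.IH assms[of n "k * n"] by (simp add: algebra_simps abs_le_iff)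
  qed
  have rate: "\<bar>a n / real n - a (k * n) / real (k * n)\<bar> \<le> 2 * C / real n"
    if "1 \<le> n" "1 \<le> k" for n k
  proof -
    have "\<bar>a n / real n - a (k * n) / real (k * n)\<bar> = \<bar>a (k * n) - real k * a n\<bar> / (real k * real n)"
    proof -
      have "a n / real n - a (k * n) / real (k * n)
          = - ((a (k * n) - real k * a n) / (real k * real n))"
        using that by (simp add: field_simps)
      then show ?thesis by (simp only: abs_minus_cancel abs_divide abs_mult abs_of_nat)
    qed
    also have "\<dots> \<le> (2 * real k * C) / (real k * real n)"
    proof (rule divide_right_mono)
      have "(real k + 1) * C \<le> 2 * real k * C" using that C by (intro mult_right_mono) auto
      then show "\<bar>a (k * n) - real k * a n\<bar> \<le> 2 * real k * C" using mult[of k n] by linarith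
    qed simp
    also have "\<dots> = 2 * C / real n" using that by simp
    finally show ?thesis .
  qed
  have "Cauchy (\<lambda>n. a n / real n)"
  proof (rule metric_CauchyI)
    fix e :: real assume e: "0 < e"
    obtain M :: nat where M: "4 * C / e < real M" using reals_Archimedean2 by blast
    have small: "2 * C / real n < e / 2" if "Suc M \<le> n" for n
    proof -
      have "4 * C < e * real n"
        using M that e by (simp add: field_simps) (smt (verit) mult_left_mono of_nat_mono of_nat_Suc)
      then show ?thesis using that by (simp add: field_simps)
    qed
    show "\<exists>M. \<forall>m\<ge>M. \<forall>n\<ge>M. dist (a m / real m) (a n / real n) < e"
    proof (intro exI allI impI)
      fix m n assume mn: "Suc M \<le> m" "Suc M \<le> n"
      define b where "b = a (n * m) / real (n * m)"
      have "\<bar>a m / real m - b\<bar> < e / 2"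
        unfolding b_def using rate[of m n] small[OF mn(1)] mn by simp
      moreover have "\<bar>a n / real n - b\<bar> < e / 2"
        unfolding b_def using rate[of n m, unfolded mult.commute[of m n]] small[OF mn(2)] mn by linarith
      ultimately show "dist (a m / real m) (a n / real n) < e"
        unfolding dist_real_def by linarith
    qed
  qed
  then show ?thesis by (simp add: Cauchy_convergent_iff)
qed

text \<open>Between consecutive squares a nondecreasing sequence with increments at most 1 moves
  by at most the square root.\<close>

lemma tendsto_div_of_squares:
  fixes s :: "nat \<Rightarrow> real"
  assumes mono: "\<And>m n. m \<le> n \<Longrightarrow> s m \<le> s n" and incr: "\<And>n k. s (n + k) \<le> s n + real k"
    and lim: "(\<lambda>k. s (k * k) / real (k * k)) \<longlonglongrightarrow> f"
  shows "(\<lambda>n. s n / real n) \<longlonglongrightarrow> f"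
proof -
  let ?r = floor_sqrt
  have r_top: "filterlim ?r at_top at_top"
  proof (rule filterlim_at_top_mono)
    show "filterlim (\<lambda>n. nat \<lfloor>sqrt (real n) - 1\<rfloor>) at_top at_top" by real_asymp
    show "\<forall>\<^sub>F n in at_top. nat \<lfloor>sqrt (real n) - 1\<rfloor> \<le> ?r n"
    proof (intro always_eventually allI)
      show "nat \<lfloor>sqrt (real n) - 1\<rfloor> \<le> ?r n" for n
        using floor_mono[OF sqrt_le_Suc_floor_sqrt[of n]] by (simp add: nat_le_iff)
    qed
  qed
  \<comment> \<open>With \<open>k * k \<le> n \<le> k * k + 2 * k\<close>, replacing
    \<open>n\<close> by \<open>k * k\<close> moves \<open>s n\<close> by at most
    \<open>2 * k\<close> and \<open>n * f\<close> by at most \<open>2 * k * \<bar>f\<bar>\<close>;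
    divided by \<open>k * k\<close> this is the second term.\<close>
  let ?e = "\<lambda>k. \<bar>s (k * k) / real (k * k) - f\<bar> + (2 + 2 * \<bar>f\<bar>) / real k"
  have "?e \<longlonglongrightarrow> 0"
  proof -
    have "(\<lambda>k. \<bar>s (k * k) / real (k * k) - f\<bar>) \<longlonglongrightarrow> 0"
      using lim by (simp add: LIM_zero tendsto_rabs_zero)
    moreover have "(\<lambda>k. (2 + 2 * \<bar>f\<bar>) / real k) \<longlonglongrightarrow> 0"
      by (rule lim_const_over_n)
    ultimately show ?thesis using tendsto_add by fastforce
  qed
  then have lim_e: "(\<lambda>n. ?e (?r n)) \<longlonglongrightarrow> 0"
    by (rule filterlim_compose[OF _ r_top])
  have "(\<lambda>n. s n / real n - f) \<longlonglongrightarrow> 0"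
  proof (rule Lim_null_comparison[OF _ lim_e])
    show "\<forall>\<^sub>F n in sequentially. norm (s n / real n - f) \<le> ?e (?r n)"
      using eventually_ge_at_top[of 1]
    proof eventually_elim
      case (elim n)
      define k where "k = ?r n"
      have k: "1 \<le> k" using elim by (simp add: k_def Suc_le_eq)
      have kn: "k * k \<le> n" using floor_sqrt_power2_le[of n] by (simp add: k_def power2_eq_square)
      have nk: "n - k * k \<le> 2 * k"
        using Suc_floor_sqrt_power2_gt[of n] by (simp add: k_def power2_eq_square)
      have "s n \<le> s (k * k) + real (n - k * k)" using incr[of "k * k" "n - k * k"] kn by simp
      moreover have "s (k * k) \<le> s n" using mono kn by simp
      ultimately have "\<bar>s n - s (k * k)\<bar> \<le> real (n - k * k)" by simp
      also have "\<dots> \<le> 2 * real k" using nk by simp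
      finally have 1: "\<bar>s n - s (k * k)\<bar> \<le> 2 * real k" .
      have "\<bar>(real (k * k) - real n) * f\<bar> = real (n - k * k) * \<bar>f\<bar>"
        using of_nat_mono[OF kn, where 'a=real] kn by (simp add: abs_mult of_nat_diff)
      also have "\<dots> \<le> 2 * real k * \<bar>f\<bar>" using nk by (intro mult_right_mono) auto
      finally have 2: "\<bar>(real (k * k) - real n) * f\<bar> \<le> 2 * real k * \<bar>f\<bar>" .
      have "s n - real n * f = (s n - s (k * k)) + (s (k * k) - real (k * k) * f)
          + (real (k * k) - real n) * f"
        by (simp add: algebra_simps)
      then have "\<bar>s n - real n * f\<bar> \<le> \<bar>s (k * k) - real (k * k) * f\<bar> + (2 + 2 * \<bar>f\<bar>) * real k"
        using 1 2 by (simp add: algebra_simps)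
      also have "\<dots> = real (k * k) * ?e k"
      proof -
        have "\<bar>s (k * k) - real (k * k) * f\<bar> = real (k * k) * \<bar>s (k * k) / real (k * k) - f\<bar>"
          using k by (simp add: abs_mult[symmetric] field_simps)
        then show ?thesis using k by (simp add: field_simps)
      qed
      also have "\<dots> \<le> real n * ?e k"
        using kn by (intro mult_right_mono) (auto simp flip: of_nat_mult)
      finally have "\<bar>s n - real n * f\<bar> \<le> real n * ?e k" .
      moreover have "\<bar>s n / real n - f\<bar> = \<bar>s n - real n * f\<bar> / real n"
      proof -
        have "s n / real n - f = (s n - real n * f) / real n"
          using elim by (simp add: field_simps)
        then show ?thesis by (simp add: abs_divide)
      qed
      ultimately show ?case
        using elim by (simp add: k_def field_simps)
    qed
  qed
  then show ?thesis by (simp add: LIM_zero_iff)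
qed

section \<open>Front and stalls\<close>

definition hit :: "nat \<Rightarrow> nat set \<Rightarrow> (nat \<times> nat \<times> nat \<Rightarrow> bool) \<Rightarrow> nat \<Rightarrow> nat set" where
  "hit N A \<omega> t = {i \<in> {1..N}. \<exists>j\<in>A. \<omega> (i, j, t)}"

text \<open>If something is hit, the maximum rises by 1 and the unhit coordinates stay at the old
  one. If nothing is hit, every coordinate still inherits the old maximum from some front
  coordinate, so all of them are at the maximum again.\<close>

fun front :: "nat \<Rightarrow> (nat \<times> nat \<times> nat \<Rightarrow> bool) \<Rightarrow> nat \<Rightarrow> nat set" where
  "front N \<omega> 0 = {1..N}"
| "front N \<omega> (Suc t) = (if hit N (front N \<omega> t) \<omega> (Suc t) = {} then {1..N}
     else hit N (front N \<omega> t) \<omega> (Suc t))"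

definition stalls :: "nat \<Rightarrow> (nat \<times> nat \<times> nat \<Rightarrow> bool) \<Rightarrow> nat \<Rightarrow> real" where
  "stalls N \<omega> n = (\<Sum>t<n. of_bool (hit N (front N \<omega> t) \<omega> (Suc t) = {}))"

definition time_shift :: "nat \<Rightarrow> (nat \<times> nat \<times> nat \<Rightarrow> bool) \<Rightarrow> nat \<times> nat \<times> nat \<Rightarrow> bool" where
  "time_shift m \<omega> = (\<lambda>(i, j, s). \<omega> (i, j, s + m))"

lemma hit_subset: "hit N A \<omega> t \<subseteq> {1..N}"
  by (auto simp: hit_def)

lemma front_subset: "front N \<omega> t \<subseteq> {1..N}"
  using hit_subset by (cases t) auto

lemma front_nonempty: "1 \<le> N \<Longrightarrow> front N \<omega> t \<noteq> {}"
  by (cases t) auto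

lemma front_cong:
  assumes "\<And>x. x \<in> {1..N} \<times> {1..N} \<times> {1..n} \<Longrightarrow> \<omega> x = \<omega>' x" "t \<le> n"
  shows "front N \<omega> t = front N \<omega>' t"
  using assms(2)
proof (induction t)
  case (Suc t)
  then have IH: "front N \<omega> t = front N \<omega>' t" by simp
  have "\<omega> (i, j, Suc t) = \<omega>' (i, j, Suc t)" if "i \<in> {1..N}" "j \<in> front N \<omega> t" for i j
    using that front_subset[of N \<omega> t] Suc.prems by (intro assms(1)) auto
  then have "hit N (front N \<omega> t) \<omega> (Suc t) = hit N (front N \<omega> t) \<omega>' (Suc t)"
    by (auto simp: hit_def)
  with IH show ?case by simp
qed simp

lemma hit_front_cong:
  assumes "\<And>x. x \<in> {1..N} \<times> {1..N} \<times> {1..n} \<Longrightarrow> \<omega> x = \<omega>' x" "t < n"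
  shows "hit N (front N \<omega> t) \<omega> (Suc t) = hit N (front N \<omega>' t) \<omega>' (Suc t)"
proof -
  have "front N \<omega> t = front N \<omega>' t"
    using assms by (intro front_cong[of N n]) auto
  moreover have "\<omega> (i, j, Suc t) = \<omega>' (i, j, Suc t)"
    if "i \<in> {1..N}" "j \<in> front N \<omega> t" for i j
    using that front_subset[of N \<omega> t] assms(2) by (intro assms(1)) auto
  then have "hit N (front N \<omega> t) \<omega> (Suc t) = hit N (front N \<omega> t) \<omega>' (Suc t)"
    by (auto simp: hit_def)
  ultimately show ?thesis by simp
qed

lemma stalls_cong:
  assumes "\<And>x. x \<in> {1..N} \<times> {1..N} \<times> {1..n} \<Longrightarrow> \<omega> x = \<omega>' x"
  shows "stalls N \<omega> n = stalls N \<omega>' n"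
  unfolding stalls_def
proof (rule sum.cong)
  fix t assume "t \<in> {..<n}"
  then have "hit N (front N \<omega> t) \<omega> (Suc t) = hit N (front N \<omega>' t) \<omega>' (Suc t)"
    by (intro hit_front_cong[OF assms]) simp_all
  then show "(of_bool (hit N (front N \<omega> t) \<omega> (Suc t) = {}) :: real) =
      of_bool (hit N (front N \<omega>' t) \<omega>' (Suc t) = {})" by simp
qed simp

lemma stalls_0 [simp]: "stalls N \<omega> 0 = 0"
  by (simp add: stalls_def)

lemma stalls_Suc: "stalls N \<omega> (Suc n) =
    stalls N \<omega> n + of_bool (hit N (front N \<omega> n) \<omega> (Suc n) = {})"
  by (simp add: stalls_def)

lemma stalls_mono: "n \<le> n' \<Longrightarrow> stalls N \<omega> n \<le> stalls N \<omega> n'"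
  by (rule lift_Suc_mono_le) (simp add: stalls_Suc)

lemma stalls_nonneg: "0 \<le> stalls N \<omega> n"
  by (simp add: stalls_def sum_nonneg)

lemma stalls_add_le: "stalls N \<omega> (n + k) \<le> stalls N \<omega> n + k"
  by (induction k) (auto simp: stalls_Suc)

lemma stalls_le: "stalls N \<omega> n \<le> n"
  using stalls_add_le[of N \<omega> 0 n] by simp

section \<open>From the process to stall counts\<close>

lemma Xproc_zero_eq:
  assumes "1 \<le> N" "i \<in> {1..N}"
  shows "Xproc N (\<lambda>_. 0) \<omega> t i = real t - stalls N \<omega> t - of_bool (i \<notin> front N \<omega> t)"
  using assms(2)
proof (induction t arbitrary: i)
  case (Suc t)
  let ?S = "front N \<omega> t" and ?c = "real t - stalls N \<omega> t"
  let ?T = "hit N ?S \<omega> (Suc t)"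
  let ?v = "\<lambda>j. Xproc N (\<lambda>_. 0) \<omega> t j + (if \<omega> (i, j, Suc t) then 1 else 0)"
  have v: "?v j = ?c - of_bool (j \<notin> ?S) + of_bool (\<omega> (i, j, Suc t))" if "j \<in> {1..N}" for j
    using Suc.IH[OF that] by simp
  have Max: "Max (?v ` {1..N}) = ?c + of_bool (i \<in> ?T)"
  proof (rule Max_eqI)
    fix y assume "y \<in> ?v ` {1..N}"
    then obtain j where "j \<in> {1..N}" "y = ?v j" by blast
    then have "y = ?c - of_bool (j \<notin> ?S) + of_bool (\<omega> (i, j, Suc t))"
      by (simp only: v)
    moreover have "i \<in> ?T" if "j \<in> ?S" "\<omega> (i, j, Suc t)"
      using that Suc.prems by (auto simp: hit_def)
    ultimately show "y \<le> ?c + of_bool (i \<in> ?T)" by auto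
  next
    \<comment> \<open>The maximum is attained within the front in both cases: a hit \<open>i\<close>
      has a front edge carrying 1; for an unhit \<open>i\<close> all front edges carry 0, and any
      front coordinate will do.\<close>
    have "\<exists>j\<in>?S. \<omega> (i, j, Suc t) \<longleftrightarrow> i \<in> ?T"
    proof (cases "i \<in> ?T")
      case True
      then show ?thesis by (auto simp: hit_def)
    next
      case False
      obtain j where "j \<in> ?S" using front_nonempty[OF assms(1)] by blast
      with False Suc.prems show ?thesis by (auto simp: hit_def)
    qed
    then obtain j where j: "j \<in> ?S" "\<omega> (i, j, Suc t) \<longleftrightarrow> i \<in> ?T"
      by blast
    then have jN: "j \<in> {1..N}" using front_subset by blast
    have vj: "?v j = ?c + of_bool (i \<in> ?T)"
      using v[OF jN] j by simp
    show "?c + of_bool (i \<in> ?T) \<in> ?v ` {1..N}"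
      by (rule image_eqI[OF _ jN]) (rule vj[symmetric])
  qed simp
  have "Xproc N (\<lambda>_. 0) \<omega> (Suc t) i = ?c + of_bool (i \<in> ?T)"
    using Max by simp
  with Suc.prems show ?case by (auto simp: stalls_Suc)
qed simp

text \<open>Max-plus linear maps are monotone and commute with adding constants. This is the only
  tool needed to compare initial conditions.\<close>

lemma Xproc_le_add:
  assumes "1 \<le> N" "\<And>i. i \<in> {1..N} \<Longrightarrow> X i \<le> Y i + c" "i \<in> {1..N}"
  shows "Xproc N X \<omega> t i \<le> Xproc N Y \<omega> t i + c"
  using assms(3)
proof (induction t arbitrary: i)
  case 0 then show ?case using assms(2) by simp
next
  case (Suc t)
  let ?Y = "\<lambda>j. Xproc N Y \<omega> t j + (if \<omega> (i, j, Suc t) then 1 else 0)"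
  have "Xproc N X \<omega> t j + (if \<omega> (i, j, Suc t) then 1 else 0) \<le> Max (?Y ` {1..N}) + c"
    if j: "j \<in> {1..N}" for j
  proof -
    have "?Y j \<le> Max (?Y ` {1..N})"
      by (rule Max_ge[OF finite_imageI[OF finite_atLeastAtMost] imageI[OF j]])
    with Suc.IH[OF j] show ?thesis by (simp split: if_splits)
  qed
  then have "Max ((\<lambda>j. Xproc N X \<omega> t j + (if \<omega> (i, j, Suc t) then 1 else 0)) ` {1..N}) \<le>
      Max (?Y ` {1..N}) + c"
    using assms(1) by (intro Max.boundedI) auto
  then show ?case by simp
qed

lemma Xproc_add: "Xproc N X \<omega> (m + n) = Xproc N (Xproc N X \<omega> m) (time_shift m \<omega>) n"
proof (induction n)
  case (Suc n)
  show ?case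
    by (rule ext) (simp add: Suc.IH time_shift_def add.commute)
qed simp

text \<open>At time \<open>m\<close> every coordinate is at \<open>?c\<close> or
  \<open>?c - 1\<close>, so the process is sandwiched between copies restarted from these two
  constant levels. Each inequality is read off at a coordinate that is in the front of the process
  with the smaller values.\<close>

lemma stalls_near_additive:
  assumes N: "1 \<le> N"
  shows "stalls N \<omega> m + stalls N (time_shift m \<omega>) n \<le> stalls N \<omega> (m + n)"
    and "stalls N \<omega> (m + n) \<le> stalls N \<omega> m + stalls N (time_shift m \<omega>) n + 1"
proof -
  let ?Z = "\<lambda>_. 0 :: real" and ?\<omega>' = "time_shift m \<omega>" and ?c = "real m - stalls N \<omega> m"
  note eq = Xproc_zero_eq[OF N]
  obtain i where i: "i \<in> front N \<omega> (m + n)" "i \<in> {1..N}"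
    using front_nonempty[OF N] front_subset by blast
  have "Xproc N (Xproc N ?Z \<omega> m) ?\<omega>' n i \<le> Xproc N ?Z ?\<omega>' n i + ?c"
    by (rule Xproc_le_add[OF N _ i(2)]) (simp add: eq)
  then show "stalls N \<omega> m + stalls N ?\<omega>' n \<le> stalls N \<omega> (m + n)"
    using i eq[OF i(2), of \<omega> "m + n"] eq[OF i(2), of ?\<omega>' n]
    by (simp add: Xproc_add split: if_splits) (auto simp: of_bool_def split: if_splits)
  obtain i where i: "i \<in> front N ?\<omega>' n" "i \<in> {1..N}"
    using front_nonempty[OF N] front_subset by blast
  have "Xproc N ?Z ?\<omega>' n i \<le> Xproc N (Xproc N ?Z \<omega> m) ?\<omega>' n i + (1 - ?c)"
    by (rule Xproc_le_add[OF N _ i(2)]) (simp add: eq of_bool_def)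
  then show "stalls N \<omega> (m + n) \<le> stalls N \<omega> m + stalls N ?\<omega>' n + 1"
    using i eq[OF i(2), of \<omega> "m + n"] eq[OF i(2), of ?\<omega>' n]
    by (auto simp: Xproc_add of_bool_def split: if_splits)
qed

text \<open>Here the initial condition disappears: it displaces the process by at most its largest
  absolute value, uniformly in time and outcome, which vanishes after division by
  \<open>t\<close>.\<close>

lemma Max_Xproc_bounds:
  assumes N: "1 \<le> N"
  shows "\<exists>C. \<forall>\<omega> t. \<bar>Max ((\<lambda>i. Xproc N X \<omega> t i) ` {1..N}) - (real t - stalls N \<omega> t)\<bar> \<le> C"
proof (intro exI allI)
  fix \<omega> t
  define C where "C = Max ((\<lambda>i. \<bar>X i\<bar>) ` {1..N})"
  have C: "\<bar>X i\<bar> \<le> C" if "i \<in> {1..N}" for i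
    using that by (auto simp: C_def)
  let ?M = "Max ((\<lambda>i. Xproc N X \<omega> t i) ` {1..N})" and ?c = "real t - stalls N \<omega> t"
  note eq = Xproc_zero_eq[OF N]
  have XC: "X i \<le> 0 + C" "0 \<le> X i + C" if "i \<in> {1..N}" for i
    using C[OF that] by auto
  have "Xproc N X \<omega> t i \<le> ?c + C" if i: "i \<in> {1..N}" for i
  proof -
    have "Xproc N X \<omega> t i \<le> Xproc N (\<lambda>_. 0) \<omega> t i + C"
      by (rule Xproc_le_add[OF N XC(1) i])
    then show ?thesis by (simp add: eq[OF i] of_bool_def split: if_splits)
  qed
  then have "?M \<le> ?c + C"
    using N by (intro Max.boundedI) auto
  moreover obtain i where i: "i \<in> front N \<omega> t" "i \<in> {1..N}"
    using front_nonempty[OF N] front_subset by blast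
  have "Xproc N (\<lambda>_. 0) \<omega> t i \<le> Xproc N X \<omega> t i + C"
    by (rule Xproc_le_add[OF N XC(2) i(2)])
  then have "?c \<le> Xproc N X \<omega> t i + C"
    by (simp add: eq[OF i(2)] i(1))
  moreover have "Xproc N X \<omega> t i \<le> ?M"
    by (rule Max_ge[OF finite_imageI[OF finite_atLeastAtMost] imageI[OF i(2)]])
  ultimately show "\<bar>?M - ?c\<bar> \<le> Max ((\<lambda>i. \<bar>X i\<bar>) ` {1..N})"
    unfolding C_def[symmetric] by linarith
qed

section \<open>Law of the front\<close>

lemma sum_Pow_card:
  fixes f :: "nat \<Rightarrow> real"
  assumes "finite S"
  shows "(\<Sum>B\<in>Pow S. f (card B)) = (\<Sum>m\<le>card S. real (card S choose m) * f m)"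
proof -
  have "(\<Sum>B\<in>Pow S. f (card B)) = (\<Sum>m\<in>{..card S}. \<Sum>B\<in>{B \<in> Pow S. card B = m}. f (card B))"
    using assms by (intro sum.group[symmetric]) (auto simp: card_mono)
  also have "\<dots> = (\<Sum>m\<le>card S. real (card S choose m) * f m)"
    using assms by (intro sum.cong) (auto simp: n_subsets)
  finally show ?thesis .
qed

lemma (in prob_space) expectation_finite_range:
  fixes \<phi> :: "'b \<Rightarrow> real"
  assumes S: "finite S" and X: "X \<in> measurable M (count_space UNIV)"
    and range: "\<And>\<omega>. \<omega> \<in> space M \<Longrightarrow> X \<omega> \<in> S"
  shows "expectation (\<lambda>\<omega>. \<phi> (X \<omega>)) = (\<Sum>s\<in>S. prob {\<omega> \<in> space M. X \<omega> = s} * \<phi> s)"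
    and "integrable M (\<lambda>\<omega>. \<phi> (X \<omega>))"
proof -
  have meas: "{\<omega> \<in> space M. X \<omega> = s} \<in> events" for s
    using measurable_sets[OF X, of "{s}"] by (simp add: vimage_def Int_def conj_commute)
  have eq: "\<phi> (X \<omega>) = (\<Sum>s\<in>S. indicator {\<omega> \<in> space M. X \<omega> = s} \<omega> * \<phi> s)" if "\<omega> \<in> space M" for \<omega>
    using that range[OF that] S by (simp add: indicator_def if_distrib[of "\<lambda>x. x * _"] sum.delta cong: if_cong)
  have int: "integrable M (\<lambda>\<omega>. indicator {\<omega> \<in> space M. X \<omega> = s} \<omega> * \<phi> s)" for s
    using meas[of s] by (intro integrable_mult_left integrable_real_indicator) (auto simp: emeasure_eq_measure)
  show "integrable M (\<lambda>\<omega>. \<phi> (X \<omega>))"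
    by (subst Bochner_Integration.integrable_cong[OF refl eq]) (auto intro!: int)
  have "expectation (\<lambda>\<omega>. \<phi> (X \<omega>)) = expectation (\<lambda>\<omega>. \<Sum>s\<in>S. indicator {\<omega> \<in> space M. X \<omega> = s} \<omega> * \<phi> s)"
    by (intro Bochner_Integration.integral_cong refl eq)
  also have "\<dots> = (\<Sum>s\<in>S. prob {\<omega> \<in> space M. X \<omega> = s} * \<phi> s)"
    using meas int by (subst Bochner_Integration.integral_sum) auto
  finally show "expectation (\<lambda>\<omega>. \<phi> (X \<omega>)) = (\<Sum>s\<in>S. prob {\<omega> \<in> space M. X \<omega> = s} * \<phi> s)" .
qed

section \<open>Independence of blocks and the transition law\<close>

locale max_plus_bernoulli =
  fixes p q :: real and N :: nat
  assumes p: "0 < p" "p < 1" and q_def: "q = 1 - p" and N: "1 \<le> N"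
begin

abbreviation \<Xi> :: "(nat \<times> nat \<times> nat \<Rightarrow> bool) measure" where
  "\<Xi> \<equiv> xi_space p N"

lemma q: "0 < q" "q < 1"
  using p by (auto simp: q_def)

sublocale prob_space \<Xi>
  unfolding xi_space_def by (intro prob_space_PiM prob_space_measure_pmf)

lemma distr_coordinate:
  assumes "x \<in> xi_index N"
  shows "distr \<Xi> (measure_pmf (bernoulli_pmf p)) (\<lambda>\<omega>. \<omega> x) = measure_pmf (bernoulli_pmf p)"
  unfolding xi_space_def
  using distr_PiM_component[of "xi_index N" "\<lambda>_. measure_pmf (bernoulli_pmf p)" x] assms
  by (simp add: prob_space_measure_pmf)

lemma coordinate_measurable:
  assumes "x \<in> xi_index N"
  shows "(\<lambda>\<omega>. \<omega> x) \<in> measurable \<Xi> (measure_pmf (bernoulli_pmf p))"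
  unfolding xi_space_def using assms by (rule measurable_component_singleton)

lemma indep_vars_coordinates:
  "indep_vars (\<lambda>_. measure_pmf (bernoulli_pmf p)) (\<lambda>x \<omega>. \<omega> x) (xi_index N)"
proof (subst indep_vars_iff_distr_eq_PiM')
  have "(1, 1, 1) \<in> xi_index N" using N by (simp add: xi_index_def)
  then show "xi_index N \<noteq> {}" by blast
  have "distr \<Xi> (Pi\<^sub>M (xi_index N) (\<lambda>_. measure_pmf (bernoulli_pmf p))) (\<lambda>\<omega>. \<lambda>x\<in>xi_index N. \<omega> x)
      = distr \<Xi> \<Xi> (\<lambda>\<omega>. \<omega>)"
    by (intro distr_cong) (auto simp: xi_space_def space_PiM PiE_def extensional_restrict)
  also have "\<dots> = \<Xi>" by (rule distr_id)
  also have "\<dots> = Pi\<^sub>M (xi_index N)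
      (\<lambda>x. distr \<Xi> (measure_pmf (bernoulli_pmf p)) (\<lambda>\<omega>. \<omega> x))"
    unfolding xi_space_def[of p N, symmetric]
    by (subst xi_space_def) (intro PiM_cong refl distr_coordinate[symmetric])
  finally show "distr \<Xi> (Pi\<^sub>M (xi_index N) (\<lambda>_. measure_pmf (bernoulli_pmf p)))
      (\<lambda>\<omega>. \<lambda>x\<in>xi_index N. \<omega> x)
    = Pi\<^sub>M (xi_index N) (\<lambda>x. distr \<Xi> (measure_pmf (bernoulli_pmf p)) (\<lambda>\<omega>. \<omega> x))" .
qed (rule coordinate_measurable)

text \<open>On a finite block the product sigma-algebra is discrete, so a function that depends on
  the block only is measurable for free and factors through the restriction. All independence below
  is an instance with suitable blocks.\<close>

lemma indep_vars_blocks: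
  fixes h :: "'l \<Rightarrow> (nat \<times> nat \<times> nat \<Rightarrow> bool) \<Rightarrow> 'c"
  assumes K: "\<And>l. l \<in> L \<Longrightarrow> finite (K l) \<and> K l \<subseteq> xi_index N" and disj: "disjoint_family_on K L"
    and dep: "\<And>l \<omega> \<omega>'. l \<in> L \<Longrightarrow> (\<And>x. x \<in> K l \<Longrightarrow> \<omega> x = \<omega>' x) \<Longrightarrow> h l \<omega> = h l \<omega>'"
  shows "indep_vars (\<lambda>_. count_space UNIV) h L"
proof -
  let ?b = "\<lambda>_. measure_pmf (bernoulli_pmf p)"
  have "indep_vars (\<lambda>l. PiM (K l) ?b) (\<lambda>l \<omega>. restrict (\<lambda>x. \<omega> x) (K l)) L"
    by (rule indep_vars_restrict[OF indep_vars_coordinates _ disj]) (use K in auto)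
  then have "indep_vars (\<lambda>_. count_space UNIV) (\<lambda>l \<omega>. h l (restrict (\<lambda>x. \<omega> x) (K l))) L"
  proof (rule indep_vars_compose2)
    fix l assume l: "l \<in> L"
    have "sets (PiM (K l) ?b) = sets (PiM (K l) (\<lambda>_. count_space UNIV))"
      by (intro sets_PiM_cong) auto
    also have "\<dots> = sets (count_space (PiE (K l) (\<lambda>_. UNIV)))"
      using K[OF l] by (subst count_space_PiM_finite) auto
    finally have "measurable (PiM (K l) ?b) (count_space UNIV :: 'c measure)
        = measurable (count_space (PiE (K l) (\<lambda>_. UNIV))) (count_space UNIV)"
      by (rule measurable_cong_sets) simp
    then show "h l \<in> measurable (PiM (K l) ?b) (count_space UNIV)" by simp
  qed
  moreover have "h l (restrict (\<lambda>x. \<omega> x) (K l)) = h l \<omega>" if "l \<in> L" for l \<omega>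
    by (rule dep[OF that]) simp
  ultimately show ?thesis
    by (subst indep_vars_cong[OF refl, where Y="\<lambda>l \<omega>. h l (restrict (\<lambda>x. \<omega> x) (K l))"]) auto
qed

text \<open>Measurability is extracted from the one-block case of
  \<open>indep_vars_blocks\<close>.\<close>

lemma block_measurable:
  assumes "finite K" "K \<subseteq> xi_index N" "\<And>\<omega> \<omega>'. (\<And>x. x \<in> K \<Longrightarrow> \<omega> x = \<omega>' x) \<Longrightarrow> h \<omega> = h \<omega>'"
  shows "h \<in> measurable \<Xi> (count_space UNIV)"
proof -
  have "indep_vars (\<lambda>_. count_space UNIV) (\<lambda>_. h) {()}"
  proof (rule indep_vars_blocks[where K="\<lambda>_. K"])
    show "finite K \<and> K \<subseteq> xi_index N" using assms(1,2) by simp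
    show "h \<omega> = h \<omega>'" if "\<And>x. x \<in> K \<Longrightarrow> \<omega> x = \<omega>' x" for \<omega> \<omega>'
      using that by (rule assms(3))
  qed (simp add: disjoint_family_on_def)
  then show ?thesis by (simp add: indep_vars_def)
qed

lemma time_window_subset: "{1..N} \<times> {1..N} \<times> {Suc s..t} \<subseteq> xi_index N"
  by (auto simp: xi_index_def)

lemma front_hit_measurable:
  "(\<lambda>\<omega>. (front N \<omega> t, hit N (front N \<omega> t) \<omega> (Suc t))) \<in> measurable \<Xi> (count_space UNIV)"
proof (rule block_measurable[where K="{1..N} \<times> {1..N} \<times> {1..Suc t}"])
  fix \<omega> \<omega>' :: "nat \<times> nat \<times> nat \<Rightarrow> bool"
  assume eq: "\<And>x. x \<in> {1..N} \<times> {1..N} \<times> {1..Suc t} \<Longrightarrow> \<omega> x = \<omega>' x"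
  show "(front N \<omega> t, hit N (front N \<omega> t) \<omega> (Suc t))
      = (front N \<omega>' t, hit N (front N \<omega>' t) \<omega>' (Suc t))"
  proof (intro arg_cong2[where f=Pair])
    show "front N \<omega> t = front N \<omega>' t"
      by (rule front_cong[where n="Suc t"]) (rule eq, simp_all)
    show "hit N (front N \<omega> t) \<omega> (Suc t) = hit N (front N \<omega>' t) \<omega>' (Suc t)"
      by (rule hit_front_cong[where n="Suc t"]) (rule eq, simp_all)
  qed
qed (use time_window_subset[of 0] in auto)

lemma front_measurable: "(\<lambda>\<omega>. front N \<omega> t) \<in> measurable \<Xi> (count_space UNIV)"
  using measurable_compose[OF front_hit_measurable[of t], of fst "count_space UNIV"] by simp

lemma stalls_measurable: "(\<lambda>\<omega>. stalls N \<omega> n) \<in> borel_measurable \<Xi>"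
proof -
  have "(\<lambda>\<omega>. stalls N \<omega> n) \<in> measurable \<Xi> (count_space UNIV)"
  proof (rule block_measurable[where K="{1..N} \<times> {1..N} \<times> {1..n}"])
    show "{1..N} \<times> {1..N} \<times> {1..n} \<subseteq> xi_index N"
      using time_window_subset[of 0] by simp
  qed (auto intro: stalls_cong)
  then show ?thesis
    by (rule measurable_compose) simp
qed

lemma prob_no_hit:
  assumes A: "A \<subseteq> {1..N}" and i: "i \<in> {1..N}"
  shows "prob {\<omega> \<in> space \<Xi>. \<forall>j\<in>A. \<not> \<omega> (i, j, Suc t)} = q ^ card A"
proof (cases "A = {}")
  case True
  then show ?thesis by (simp add: prob_space)
next
  case False
  let ?J = "(\<lambda>j. (i, j, Suc t)) ` A"
  have J: "?J \<subseteq> xi_index N" using A i by (auto simp: xi_index_def)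
  have fin: "finite A" using A finite_subset by blast
  have "{\<omega> \<in> space \<Xi>. \<forall>j\<in>A. \<not> \<omega> (i, j, Suc t)} = (\<Inter>x\<in>?J. (\<lambda>\<omega>. \<omega> x) -` {False} \<inter> space \<Xi>)"
    using False by auto
  also have "prob \<dots> = (\<Prod>x\<in>?J. prob ((\<lambda>\<omega>. \<omega> x) -` {False} \<inter> space \<Xi>))"
    using False J fin by (intro indep_varsD[OF indep_vars_coordinates]) auto
  also have "\<dots> = (\<Prod>x\<in>?J. q)"
  proof (rule prod.cong)
    fix x assume "x \<in> ?J"
    then have x: "x \<in> xi_index N" using J by blast
    have "prob ((\<lambda>\<omega>. \<omega> x) -` {False} \<inter> space \<Xi>)
        = measure (distr \<Xi> (measure_pmf (bernoulli_pmf p)) (\<lambda>\<omega>. \<omega> x)) {False}"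
      using coordinate_measurable[OF x] by (subst measure_distr) auto
    also have "\<dots> = q"
      using p by (simp add: distr_coordinate[OF x] measure_pmf_single q_def)
    finally show "prob ((\<lambda>\<omega>. \<omega> x) -` {False} \<inter> space \<Xi>) = q" .
  qed simp
  also have "\<dots> = q ^ card A"
    by (simp add: card_image inj_on_def)
  finally show ?thesis .
qed

text \<open>The front at time \<open>t\<close> depends on the past only, and given \<open>A\<close>
  the coordinates are hit through disjoint sets of fresh variables, each with probability
  \<open>1 - q ^ card A\<close>.\<close>

lemma prob_front_hit:
  assumes A: "A \<subseteq> {1..N}" and B: "B \<subseteq> {1..N}"
  shows "prob {\<omega> \<in> space \<Xi>. (front N \<omega> t, hit N (front N \<omega> t) \<omega> (Suc t)) = (A, B)}
    = prob {\<omega> \<in> space \<Xi>. front N \<omega> t = A}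
      * ((1 - q ^ card A) ^ card B * (q ^ card A) ^ (N - card B))"
proof -
  \<comment> \<open>Coordinates start at 1, so index 0 is free to denote the past up to time
    \<open>t\<close>; index \<open>l\<close> denotes row \<open>l\<close> at time
    \<open>Suc t\<close>.\<close>
  define K :: "nat \<Rightarrow> (nat \<times> nat \<times> nat) set" where
    "K = (\<lambda>l. if l = 0 then {1..N} \<times> {1..N} \<times> {1..t} else {l} \<times> {1..N} \<times> {Suc t})"
  define h where "h = (\<lambda>l \<omega>. if l = 0 then front N \<omega> t = A
    else (\<exists>j\<in>A. \<omega> (l, j, Suc t)) \<longleftrightarrow> l \<in> B)"
  have indep: "indep_vars (\<lambda>_. count_space UNIV) h {0..N}"
  proof (rule indep_vars_blocks[where K=K])
    show "finite (K l) \<and> K l \<subseteq> xi_index N" if "l \<in> {0..N}" for l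
      using that by (auto simp: K_def xi_index_def)
    show "disjoint_family_on K {0..N}"
      by (auto simp: disjoint_family_on_def K_def)
    fix l and \<omega> \<omega>' :: "nat \<times> nat \<times> nat \<Rightarrow> bool"
    assume l: "l \<in> {0..N}" and eq: "\<And>x. x \<in> K l \<Longrightarrow> \<omega> x = \<omega>' x"
    show "h l \<omega> = h l \<omega>'"
    proof (cases "l = 0")
      case True
      then have "front N \<omega> t = front N \<omega>' t"
        using eq by (intro front_cong[of N t]) (auto simp: K_def)
      with True show ?thesis by (simp add: h_def)
    next
      case False
      then have "\<omega> (l, j, Suc t) = \<omega>' (l, j, Suc t)" if "j \<in> A" for j
        using that A by (intro eq) (auto simp: K_def)
      with False show ?thesis by (auto simp: h_def)
    qed
  qed
  have ev: "{\<omega> \<in> space \<Xi>. h l \<omega>} \<in> events" if "l \<in> {0..N}" for l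
  proof -
    have "h l \<in> measurable \<Xi> (count_space UNIV)"
      using indep that by (auto simp: indep_vars_def)
    from measurable_sets[OF this, of "{True}"] show ?thesis
      by (simp add: vimage_def Int_def conj_commute)
  qed
  have hit: "prob {\<omega> \<in> space \<Xi>. h l \<omega>} = (if l \<in> B then 1 - q ^ card A else q ^ card A)"
    if l: "l \<in> {1..N}" for l
  proof (cases "l \<in> B")
    case False
    have "{\<omega> \<in> space \<Xi>. h l \<omega>} = {\<omega> \<in> space \<Xi>. \<forall>j\<in>A. \<not> \<omega> (l, j, Suc t)}"
      using False l by (auto simp: h_def)
    then show ?thesis using False prob_no_hit[OF A l, of t] by simp
  next
    case True
    have "{\<omega> \<in> space \<Xi>. \<forall>j\<in>A. \<not> \<omega> (l, j, Suc t)} = space \<Xi> - {\<omega> \<in> space \<Xi>. h l \<omega>}"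
      using True l by (auto simp: h_def)
    then have "q ^ card A = 1 - prob {\<omega> \<in> space \<Xi>. h l \<omega>}"
      using prob_no_hit[OF A l, of t] prob_compl[OF ev[of l]] l by simp
    then show ?thesis using True by simp
  qed
  have "{\<omega> \<in> space \<Xi>. (front N \<omega> t, hit N (front N \<omega> t) \<omega> (Suc t)) = (A, B)}
      = (\<Inter>l\<in>{0..N}. h l -` {True} \<inter> space \<Xi>)" (is "?E = ?H")
  proof (intro equalityI subsetI)
    fix \<omega> assume "\<omega> \<in> ?E"
    then have "\<omega> \<in> space \<Xi>" "front N \<omega> t = A" "hit N A \<omega> (Suc t) = B" by auto
    then show "\<omega> \<in> ?H" by (auto simp: h_def hit_def)
  next
    fix \<omega> assume "\<omega> \<in> ?H"
    then have h: "\<omega> \<in> space \<Xi>" "h l \<omega>" if "l \<le> N" for l using that by auto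
    have "front N \<omega> t = A" using h(2)[of 0] by (simp add: h_def)
    moreover have "(\<exists>j\<in>A. \<omega> (l, j, Suc t)) \<longleftrightarrow> l \<in> B" if "l \<in> {1..N}" for l
      using h(2)[of l] that by (simp add: h_def)
    then have "hit N A \<omega> (Suc t) = B" using B by (auto simp: hit_def)
    ultimately show "\<omega> \<in> ?E" using h(1)[of 0] by simp
  qed
  also have "prob ?H = (\<Prod>l\<in>{0..N}. prob (h l -` {True} \<inter> space \<Xi>))"
    by (rule indep_varsD_finite[OF indep]) auto
  also have "\<dots> = (\<Prod>l\<in>{0..N}. prob {\<omega> \<in> space \<Xi>. h l \<omega>})"
    by (intro prod.cong arg_cong[where f=prob]) auto
  also have "\<dots> = prob {\<omega> \<in> space \<Xi>. h 0 \<omega>} * (\<Prod>l\<in>{1..N}. prob {\<omega> \<in> space \<Xi>. h l \<omega>})"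
    by (simp add: prod.atLeast_Suc_atMost)
  also have "(\<Prod>l\<in>{1..N}. prob {\<omega> \<in> space \<Xi>. h l \<omega>})
      = (\<Prod>l\<in>{1..N}. if l \<in> B then 1 - q ^ card A else q ^ card A)"
    by (intro prod.cong hit refl)
  also have "\<dots> = (1 - q ^ card A) ^ card B * (q ^ card A) ^ (N - card B)"
  proof -
    have "{1..N} \<inter> {l. l \<in> B} = B" "{1..N} \<inter> - {l. l \<in> B} = {1..N} - B"
      using B by auto
    moreover have "card ({1..N} - B) = N - card B"
      using B by (subst card_Diff_subset) (auto intro: finite_subset)
    ultimately show ?thesis by (simp add: prod.If_cases)
  qed
  finally show ?thesis by (simp add: h_def)
qed

text \<open>The transition operator for the number of hit coordinates, before the reset:
  \<open>\<psi> 0\<close> is the value attached to a stall.\<close>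

definition binom_mean :: "(nat \<Rightarrow> real) \<Rightarrow> nat \<Rightarrow> real" where
  "binom_mean \<psi> k = (\<Sum>m\<le>N. real (N choose m) * ((1 - q ^ k) ^ m * (q ^ k) ^ (N - m)) * \<psi> m)"

lemma integrable_hit: "integrable \<Xi> (\<lambda>\<omega>. \<phi> (card (hit N (front N \<omega> t) \<omega> (Suc t))) :: real)"
  using expectation_finite_range(2)[OF _ front_hit_measurable[of t],
      of "Pow {1..N} \<times> Pow {1..N}" "\<lambda>(A, B). \<phi> (card B)"] front_subset hit_subset
  by auto

lemma integrable_front: "integrable \<Xi> (\<lambda>\<omega>. \<phi> (card (front N \<omega> t)) :: real)"
  using expectation_finite_range(2)[OF _ front_measurable[of t],
      of "Pow {1..N}" "\<lambda>A. \<phi> (card A)"] front_subset by auto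

text \<open>The Markov property in integrated form, obtained by summing over all pairs of front and
  hit set instead of conditioning.\<close>

lemma expectation_hit:
  "expectation (\<lambda>\<omega>. \<psi> (card (hit N (front N \<omega> t) \<omega> (Suc t))))
    = expectation (\<lambda>\<omega>. binom_mean \<psi> (card (front N \<omega> t)))"
proof -
  let ?I = "{1..N}"
  let ?w = "\<lambda>a b. (1 - q ^ a) ^ b * (q ^ a) ^ (N - b)"
  have "expectation (\<lambda>\<omega>. \<psi> (card (hit N (front N \<omega> t) \<omega> (Suc t))))
      = (\<Sum>s\<in>Pow ?I \<times> Pow ?I.
          prob {\<omega> \<in> space \<Xi>. (front N \<omega> t, hit N (front N \<omega> t) \<omega> (Suc t)) = s} * \<psi> (card (snd s)))"
    using expectation_finite_range(1)[OF _ front_hit_measurable[of t],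
      of "Pow ?I \<times> Pow ?I" "\<lambda>s. \<psi> (card (snd s))"] front_subset hit_subset by simp
  also have "\<dots> = (\<Sum>A\<in>Pow ?I. \<Sum>B\<in>Pow ?I.
      prob {\<omega> \<in> space \<Xi>. (front N \<omega> t, hit N (front N \<omega> t) \<omega> (Suc t)) = (A, B)} * \<psi> (card B))"
    by (subst sum.cartesian_product) (auto intro: sum.cong)
  also have "\<dots> = (\<Sum>A\<in>Pow ?I. \<Sum>B\<in>Pow ?I.
      prob {\<omega> \<in> space \<Xi>. front N \<omega> t = A} * (?w (card A) (card B) * \<psi> (card B)))"
    by (intro sum.cong refl) (subst prob_front_hit, auto simp: mult_ac)
  also have "\<dots> = (\<Sum>A\<in>Pow ?I. prob {\<omega> \<in> space \<Xi>. front N \<omega> t = A} *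
      (\<Sum>B\<in>Pow ?I. ?w (card A) (card B) * \<psi> (card B)))"
    by (simp add: sum_distrib_left)
  also have "\<dots> = (\<Sum>A\<in>Pow ?I. prob {\<omega> \<in> space \<Xi>. front N \<omega> t = A} * binom_mean \<psi> (card A))"
    by (subst sum_Pow_card) (auto simp: binom_mean_def mult.assoc)
  also have "\<dots> = expectation (\<lambda>\<omega>. binom_mean \<psi> (card (front N \<omega> t)))"
    using expectation_finite_range(1)[OF _ front_measurable[of t],
      of "Pow ?I" "\<lambda>A. binom_mean \<psi> (card A)"] front_subset by simp
  finally show ?thesis .
qed

section \<open>Drift bounds on the mean number of stalls\<close>

definition mean_stalls :: "nat \<Rightarrow> real" where
  "mean_stalls n = expectation (\<lambda>\<omega>. stalls N \<omega> n)"

lemma card_front: "card (front N \<omega> t) \<in> {1..N}"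
proof -
  have "finite (front N \<omega> t)" by (rule finite_subset[OF front_subset]) simp
  then have "0 < card (front N \<omega> t)" using front_nonempty[OF N] by (simp add: card_gt_0_iff)
  moreover have "card (front N \<omega> t) \<le> N"
    using card_mono[OF _ front_subset[of N \<omega> t]] by simp
  ultimately show ?thesis by simp
qed

lemma finite_hit: "finite (hit N A \<omega> t)"
  by (rule finite_subset[OF hit_subset]) simp

lemma integrable_stalls: "integrable \<Xi> (\<lambda>\<omega>. stalls N \<omega> n)"
  by (rule integrable_const_bound[where B="real n"])
     (auto simp: stalls_nonneg stalls_le stalls_measurable)

text \<open>The outcome \<open>m = 0\<close> adds one stall and restarts from a full front, which
  explains the value \<open>1 + u N\<close>.\<close>

lemma mean_stalls_step:
  "mean_stalls (Suc n) + expectation (\<lambda>\<omega>. u (card (front N \<omega> (Suc n))))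
    = mean_stalls n
      + expectation (\<lambda>\<omega>. binom_mean (\<lambda>m. if m = 0 then 1 + u N else u m) (card (front N \<omega> n)))"
proof -
  let ?\<psi> = "\<lambda>m. if m = 0 then 1 + u N else u m"
  have "mean_stalls (Suc n) + expectation (\<lambda>\<omega>. u (card (front N \<omega> (Suc n))))
      = expectation (\<lambda>\<omega>. stalls N \<omega> (Suc n) + u (card (front N \<omega> (Suc n))))"
    unfolding mean_stalls_def
    by (rule Bochner_Integration.integral_add[symmetric, OF integrable_stalls integrable_front])
  also have "\<dots> = expectation (\<lambda>\<omega>. stalls N \<omega> n + ?\<psi> (card (hit N (front N \<omega> n) \<omega> (Suc n))))"
    by (intro Bochner_Integration.integral_cong refl) (simp add: stalls_Suc finite_hit)
  also have "\<dots> = mean_stalls n + expectation (\<lambda>\<omega>. ?\<psi> (card (hit N (front N \<omega> n) \<omega> (Suc n))))"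
    unfolding mean_stalls_def
    by (rule Bochner_Integration.integral_add[OF integrable_stalls integrable_hit])
  finally show ?thesis by (simp only: expectation_hit[of ?\<psi>])
qed

text \<open>Stalls plus potential grow by at most \<open>w\<close> per step in mean; the start
  contributes \<open>u N\<close> because the front is full at time 0.\<close>

lemma mean_stalls_upper_drift:
  assumes "\<And>k. k \<in> {1..N} \<Longrightarrow> binom_mean (\<lambda>m. if m = 0 then 1 + u N else u m) k \<le> u k + w"
  shows "mean_stalls n + expectation (\<lambda>\<omega>. u (card (front N \<omega> n))) \<le> real n * w + u N"
proof (induction n)
  case 0
  then show ?case by (simp add: mean_stalls_def prob_space)
next
  case (Suc n)
  have "expectation (\<lambda>\<omega>. binom_mean (\<lambda>m. if m = 0 then 1 + u N else u m) (card (front N \<omega> n)))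
      \<le> expectation (\<lambda>\<omega>. u (card (front N \<omega> n)) + w)"
    by (intro integral_mono assms card_front integrable_front[of "binom_mean _"]
        integrable_front[of "\<lambda>k. u k + w"])
  also have "\<dots> = expectation (\<lambda>\<omega>. u (card (front N \<omega> n))) + w"
    using integrable_front[of u n] by (simp add: prob_space)
  finally show ?case
    using Suc.IH mean_stalls_step[of n u] by (simp add: algebra_simps)
qed

text \<open>A gain of \<open>w\<close> is demanded only at a full front, so the bound involves the
  expected time spent there, which \<open>expectation_front_full\<close> controls.\<close>

lemma mean_stalls_lower_drift:
  assumes "\<And>k. k \<in> {1..N} \<Longrightarrow> u k + w * of_bool (k = N) \<le>
    binom_mean (\<lambda>m. if m = 0 then 1 + u N else u m) k"
  shows "u N + w * (\<Sum>t<n. expectation (\<lambda>\<omega>. of_bool (card (front N \<omega> t) = N)))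
    \<le> mean_stalls n + expectation (\<lambda>\<omega>. u (card (front N \<omega> n)))"
proof (induction n)
  case 0
  then show ?case by (simp add: mean_stalls_def prob_space)
next
  case (Suc n)
  have full: "integrable \<Xi> (\<lambda>\<omega>. of_bool (card (front N \<omega> n) = N) :: real)"
    by (rule integrable_front[of "\<lambda>k. of_bool (k = N)"])
  have "expectation (\<lambda>\<omega>. u (card (front N \<omega> n))) + w * expectation (\<lambda>\<omega>. of_bool (card (front N \<omega> n) = N))
      = expectation (\<lambda>\<omega>. u (card (front N \<omega> n)) + w * of_bool (card (front N \<omega> n) = N))"
    using integrable_front[of u n] full by simp
  also have "\<dots> \<le> expectation (\<lambda>\<omega>. binom_mean (\<lambda>m. if m = 0 then 1 + u N else u m) (card (front N \<omega> n)))"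
    by (intro integral_mono assms card_front integrable_front[of "binom_mean _"]
        integrable_front[of "\<lambda>k. u k + w * of_bool (k = N)"])
  finally show ?case
    using Suc.IH mean_stalls_step[of n u] by (simp add: algebra_simps)
qed

section \<open>The front is full most of the time\<close>

lemma binom_mean_power: "binom_mean (\<lambda>m. x ^ m) k = (x * (1 - q ^ k) + q ^ k) ^ N"
  unfolding binom_mean_def
  by (subst binomial_ring) (auto intro!: sum.cong simp: power_mult_distrib mult_ac)

text \<open>A reset only enlarges the front, so the hit set may replace it. From a nonempty front
  each coordinate is hit with probability at least \<open>p\<close>, so its factor has mean at most
  \<open>q * p + q\<close>, which is \<open>1 - p\<^sup>2\<close>.\<close>

lemma expectation_power_card_front:
  "expectation (\<lambda>\<omega>. q ^ card (front N \<omega> (Suc t))) \<le> (1 - p\<^sup>2) ^ N"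
proof -
  have "expectation (\<lambda>\<omega>. q ^ card (front N \<omega> (Suc t)))
      \<le> expectation (\<lambda>\<omega>. q ^ card (hit N (front N \<omega> t) \<omega> (Suc t)))"
    using q by (intro integral_mono integrable_front[of "\<lambda>k. q ^ k"] integrable_hit[of "\<lambda>k. q ^ k"])
      (auto simp: power_le_one)
  also have "\<dots> = expectation (\<lambda>\<omega>. (q * (1 - q ^ card (front N \<omega> t)) + q ^ card (front N \<omega> t)) ^ N)"
    by (simp only: expectation_hit[of "\<lambda>m. q ^ m"] binom_mean_power)
  also have "\<dots> \<le> expectation (\<lambda>\<omega>. (1 - p\<^sup>2) ^ N)"
  proof (intro integral_mono power_mono)
    fix \<omega>
    let ?y = "q ^ card (front N \<omega> t)"
    have "?y \<le> q ^ 1" using q card_front[of \<omega> t] by (intro power_decreasing) auto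
    then have "p * ?y \<le> p * q" using p by simp
    then have "q * (1 - ?y) + ?y \<le> q + p * q"
      unfolding q_def by (simp add: algebra_simps)
    then show "q * (1 - ?y) + ?y \<le> 1 - p\<^sup>2"
      by (simp add: q_def algebra_simps power2_eq_square)
    show "0 \<le> q * (1 - ?y) + ?y" using q by (simp add: power_le_one)
  qed (auto intro: integrable_front[of "\<lambda>k. (q * (1 - q ^ k) + q ^ k) ^ N"])
  finally show ?thesis by (simp add: prob_space)
qed

text \<open>Two steps suffice from any front: after the first, \<open>q ^ card\<close> of the front
  is small in mean; in the second, by Bernoulli's inequality, all coordinates are hit except with
  probability at most \<open>N\<close> times that. An empty hit set counts as full because of the
  reset.\<close>

lemma expectation_front_full:
  "1 - real N * (1 - p\<^sup>2) ^ N \<le> expectation (\<lambda>\<omega>. of_bool (card (front N \<omega> (Suc (Suc t))) = N))"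
proof -
  let ?full = "\<lambda>m. of_bool (m = 0 \<or> m = N) :: real"
  have "1 - real N * q ^ k \<le> binom_mean ?full k" for k
  proof -
    have "1 - real N * q ^ k \<le> (1 - q ^ k) ^ N"
      using Bernoulli_inequality[of "- (q ^ k)" N] q by (simp add: power_le_one)
    also have "\<dots> = (\<Sum>m\<in>{N}. real (N choose m) * ((1 - q ^ k) ^ m * (q ^ k) ^ (N - m)) * ?full m)"
      by simp
    also have "\<dots> \<le> binom_mean ?full k"
      unfolding binom_mean_def using q by (intro sum_mono2) (auto simp: power_le_one)
    finally show ?thesis .
  qed
  then have "expectation (\<lambda>\<omega>. 1 - real N * q ^ card (front N \<omega> (Suc t)))
      \<le> expectation (\<lambda>\<omega>. binom_mean ?full (card (front N \<omega> (Suc t))))"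
    by (intro integral_mono integrable_front[of "binom_mean _"]
        integrable_front[of "\<lambda>k. 1 - real N * q ^ k"])
  also have "\<dots> = expectation (\<lambda>\<omega>. ?full (card (hit N (front N \<omega> (Suc t)) \<omega> (Suc (Suc t)))))"
    by (rule expectation_hit[of ?full, symmetric])
  also have "\<dots> = expectation (\<lambda>\<omega>. of_bool (card (front N \<omega> (Suc (Suc t))) = N))"
    by (intro Bochner_Integration.integral_cong refl) (auto simp: finite_hit)
  finally have "1 - real N * expectation (\<lambda>\<omega>. q ^ card (front N \<omega> (Suc t)))
      \<le> expectation (\<lambda>\<omega>. of_bool (card (front N \<omega> (Suc (Suc t))) = N))"
    using integrable_front[of "\<lambda>k. q ^ k" "Suc t"] by (simp add: prob_space del: front.simps)
  moreover have "real N * expectation (\<lambda>\<omega>. q ^ card (front N \<omega> (Suc t))) \<le> real N * (1 - p\<^sup>2) ^ N"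
    by (intro mult_left_mono expectation_power_card_front) simp
  ultimately show ?thesis by linarith
qed

section \<open>Test functions and the bounds on the mean\<close>

lemma binom_mean_split:
  "binom_mean \<psi> k = (q ^ k) ^ N * \<psi> 0
    + (\<Sum>m=1..<N. real (N choose m) * ((1 - q ^ k) ^ m * (q ^ k) ^ (N - m)) * \<psi> m)
    + (1 - q ^ k) ^ N * \<psi> N"
proof -
  have "{..N} = insert 0 (insert N {1..<N})" using N by auto
  then show ?thesis unfolding binom_mean_def using N by simp
qed

text \<open>Both exponents equal \<open>k * N + (N - k) * m\<close>. For \<open>k = N\<close> the
  right side is free of \<open>m\<close>, so all hit sets are equally costly; this is the source of
  \<open>2 ^ N\<close>.\<close>

lemma power_exchange:
  assumes "k \<le> N" "m \<le> N"
  shows "(q ^ k) ^ (N - m) * q ^ (m * N) = q ^ (k * N) * (q ^ (N - k)) ^ m"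
proof -
  obtain a where a: "N = k + a" using assms(1) le_Suc_ex by blast
  obtain b where b: "N = m + b" using assms(2) le_Suc_ex by blast
  have "k * b + m * N = k * N + a * m"
    using arg_cong[OF a, of "\<lambda>x. m * x"] arg_cong[OF b, of "\<lambda>x. k * x"] by (simp add: algebra_simps)
  moreover have "N - m = b" "N - k = a" using a b by simp_all
  ultimately have "k * (N - m) + m * N = k * N + (N - k) * m" by simp
  then show ?thesis by (simp only: power_mult[symmetric] power_add[symmetric])
qed

text \<open>The test function bounds the probability of stalling before the front is full again: stalling
  at once has probability \<^term>\<open>q ^ (k * N)\<close>, stalling one step later at most
  \<^term>\<open>q ^ (k * N) * excess q N (N - k)\<close>, and doubling the latter absorbs all later steps.\<close>

lemma mean_stalls_le:
  assumes H: "\<And>j. 1 \<le> j \<Longrightarrow>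
    (\<Sum>m=1..<N. real (N choose m) * (q ^ j) ^ m * (1 + 2 * excess q N (N - m))) \<le> 2 * excess q N j"
  shows "mean_stalls n \<le> real n *
    (q ^ (N * N) * (2 ^ N + 2 * (\<Sum>m=1..<N. real (N choose m) * excess q N (N - m))))"
proof -
  define D where "D = excess q N"
  have D0: "0 \<le> D i" for i using q by (simp add: D_def excess_nonneg)
  \<comment> \<open>Value 0 at \<open>N\<close>: filling the front ends the excursion without a
    stall.\<close>
  define u where "u = (\<lambda>k. if k = N then 0 else q ^ (k * N) * (1 + 2 * D (N - k)))"
  define w where "w = q ^ (N * N) * (2 ^ N + 2 * (\<Sum>m=1..<N. real (N choose m) * D (N - m)))"
  have u0: "0 \<le> u k" for k using q D0 by (simp add: u_def)
  have w0: "0 \<le> w" using q D0 by (simp add: w_def sum_nonneg)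
  have main: "binom_mean (\<lambda>m. if m = 0 then 1 + u N else u m) k
      \<le> q ^ (k * N) * (1 + (\<Sum>m=1..<N. real (N choose m) * (q ^ (N - k)) ^ m * (1 + 2 * D (N - m))))"
    if k: "k \<in> {1..N}" for k
  proof -
    have "real (N choose m) * ((1 - q ^ k) ^ m * (q ^ k) ^ (N - m)) * u m
        \<le> q ^ (k * N) * (real (N choose m) * (q ^ (N - k)) ^ m * (1 + 2 * D (N - m)))"
      if m: "m \<in> {1..<N}" for m
    proof -
      have "real (N choose m) * ((1 - q ^ k) ^ m * (q ^ k) ^ (N - m)) * u m
          \<le> real (N choose m) * (1 * (q ^ k) ^ (N - m)) * u m"
        using q u0 by (intro mult_left_mono mult_right_mono) (auto intro: power_le_one simp: power_le_one)
      also have "\<dots> = real (N choose m) * ((q ^ k) ^ (N - m) * q ^ (m * N)) * (1 + 2 * D (N - m))"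
        using m by (simp add: u_def)
      also have "\<dots> = q ^ (k * N) * (real (N choose m) * (q ^ (N - k)) ^ m * (1 + 2 * D (N - m)))"
        using k m by (subst power_exchange) auto
      finally show ?thesis .
    qed
    then have "(\<Sum>m=1..<N. real (N choose m) * ((1 - q ^ k) ^ m * (q ^ k) ^ (N - m))
          * (if m = 0 then 1 + u N else u m))
        \<le> (\<Sum>m=1..<N. q ^ (k * N) * (real (N choose m) * (q ^ (N - k)) ^ m * (1 + 2 * D (N - m))))"
      by (intro sum_mono) auto
    moreover have "u N = 0" by (simp add: u_def)
    ultimately show ?thesis
      unfolding binom_mean_split using N
      by (simp add: power_mult sum_distrib_left[symmetric] distrib_left[of "(q ^ k) ^ N" 1])
  qed
  have "binom_mean (\<lambda>m. if m = 0 then 1 + u N else u m) k \<le> u k + w" if k: "k \<in> {1..N}" for k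
  proof (cases "k = N")
    case False
    then have "(\<Sum>m=1..<N. real (N choose m) * (q ^ (N - k)) ^ m * (1 + 2 * D (N - m))) \<le> 2 * D (N - k)"
      unfolding D_def using k by (intro H) auto
    then have "q ^ (k * N) * (1 + (\<Sum>m=1..<N. real (N choose m) * (q ^ (N - k)) ^ m * (1 + 2 * D (N - m))))
        \<le> u k"
      using False q by (simp add: u_def)
    with main[OF k] w0 show ?thesis by linarith
  next
    case True
    \<comment> \<open>At a full front, stalling at once and passing through each size
      \<open>m < N\<close> contribute \<open>N choose m\<close> apiece, together at most
      \<open>2 ^ N\<close>; the terms with \<open>D\<close> form the correction in
      \<open>w\<close>.\<close>
    have "1 + (\<Sum>m=1..<N. real (N choose m)) \<le> (\<Sum>m\<in>{0..N}. real (N choose m))"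
    proof -
      have "1 + (\<Sum>m=1..<N. real (N choose m)) = (\<Sum>m\<in>insert 0 {1..<N}. real (N choose m))" by simp
      also have "\<dots> \<le> (\<Sum>m\<in>{0..N}. real (N choose m))" by (intro sum_mono2) auto
      finally show ?thesis .
    qed
    also have "\<dots> = 2 ^ N"
      using choose_row_sum[of N] by (metis atMost_atLeast0 of_nat_numeral of_nat_power of_nat_sum)
    finally have "1 + (\<Sum>m=1..<N. real (N choose m) * (1 + 2 * D (N - m)))
        \<le> 2 ^ N + 2 * (\<Sum>m=1..<N. real (N choose m) * D (N - m))"
      by (simp add: distrib_left sum.distrib sum_distrib_left mult_ac)
    then have "q ^ (N * N) * (1 + (\<Sum>m=1..<N. real (N choose m) * (1 + 2 * D (N - m)))) \<le> w"
      unfolding w_def using q by (intro mult_left_mono) auto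
    with main[OF k] True show ?thesis using u0[of k] by simp
  qed
  then have "mean_stalls n + expectation (\<lambda>\<omega>. u (card (front N \<omega> n))) \<le> real n * w + u N"
    by (rule mean_stalls_upper_drift)
  moreover have "0 \<le> expectation (\<lambda>\<omega>. u (card (front N \<omega> n)))"
    using u0 by (simp add: integral_nonneg)
  moreover have "u N = 0" by (simp add: u_def)
  ultimately show ?thesis by (simp add: w_def D_def)
qed

text \<open>Only immediate stalls are credited: for \<open>k < N\<close> the term
  \<open>m = 0\<close> alone already yields \<open>u k\<close>. At \<open>k = N\<close> the sum is
  \<open>(2 - q ^ N) ^ N - (1 - q ^ N) ^ N\<close>, and the subtracted power is at most 1. The final
  \<open>- 1\<close> comes from \<open>u \<le> 1\<close> at the last time.\<close>

lemma mean_stalls_ge: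
  "q ^ (N * N) * ((2 - q ^ N) ^ N - 1) * (1 - real N * (1 - p\<^sup>2) ^ N) * real n - 1
    \<le> mean_stalls (Suc (Suc n))"
proof -
  define u where "u = (\<lambda>k. if k = N then 0 else q ^ (k * N))"
  define w where "w = q ^ (N * N) * ((2 - q ^ N) ^ N - 1)"
  have u: "0 \<le> u k" "u k \<le> 1" for k using q by (auto simp: u_def power_le_one)
  have qN: "0 \<le> 1 - q ^ N" "1 - q ^ N \<le> 1" using q by (auto simp: power_le_one)
  have w0: "0 \<le> w" using q by (simp add: w_def power_le_one)
  have "u k + w * of_bool (k = N) \<le> binom_mean (\<lambda>m. if m = 0 then 1 + u N else u m) k"
    if k: "k \<in> {1..N}" for k
  proof (cases "k = N")
    case False
    have "0 \<le> (\<Sum>m=1..<N. real (N choose m) * ((1 - q ^ k) ^ m * (q ^ k) ^ (N - m))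
        * (if m = 0 then 1 + u N else u m))"
      using q u by (intro sum_nonneg) (auto simp: power_le_one)
    moreover have "0 \<le> (1 - q ^ k) ^ N * (if N = 0 then 1 + u N else u N)"
      using q u by (simp add: power_le_one)
    ultimately show ?thesis
      unfolding binom_mean_split using False by (simp add: u_def power_mult)
  next
    case True
    have "(\<Sum>m=1..<N. real (N choose m) * ((1 - q ^ N) ^ m * (q ^ N) ^ (N - m)) * (if m = 0 then 1 + u N else u m))
        = q ^ (N * N) * (\<Sum>m=1..<N. real (N choose m) * (1 - q ^ N) ^ m)"
      unfolding sum_distrib_left
    proof (rule sum.cong)
      fix m assume m: "m \<in> {1..<N}"
      have "(q ^ N) ^ (N - m) * q ^ (m * N) = q ^ (N * N)"
        using power_exchange[of N m] m by simp
      then show "real (N choose m) * ((1 - q ^ N) ^ m * (q ^ N) ^ (N - m)) * (if m = 0 then 1 + u N else u m)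
          = q ^ (N * N) * (real (N choose m) * (1 - q ^ N) ^ m)"
        using m by (auto simp: u_def mult_ac)
    qed simp
    then have "binom_mean (\<lambda>m. if m = 0 then 1 + u N else u m) k
        = q ^ (N * N) * (1 + (\<Sum>m=1..<N. real (N choose m) * (1 - q ^ N) ^ m))"
      unfolding binom_mean_split True using N by (simp add: u_def power_mult distrib_left)
    moreover have "(2 - q ^ N) ^ N
        = 1 + (\<Sum>m=1..<N. real (N choose m) * (1 - q ^ N) ^ m) + (1 - q ^ N) ^ N"
    proof -
      have "{..N} = insert 0 (insert N {1..<N})" using N by auto
      moreover have "(2 - q ^ N) ^ N = (\<Sum>m\<le>N. real (N choose m) * (1 - q ^ N) ^ m)"
        using binomial_ring[of "1 - q ^ N" 1 N] by simp
      ultimately show ?thesis using N by simp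
    qed
    moreover have "(1 - q ^ N) ^ N \<le> 1" using qN by (intro power_le_one)
    ultimately have "w \<le> binom_mean (\<lambda>m. if m = 0 then 1 + u N else u m) k"
      unfolding w_def using q by (simp add: mult_left_mono)
    then show ?thesis using True by (simp add: u_def)
  qed
  from mean_stalls_lower_drift[of u w, OF this, of "Suc (Suc n)"]
  have "w * (\<Sum>t<Suc (Suc n). expectation (\<lambda>\<omega>. of_bool (card (front N \<omega> t) = N)))
      \<le> mean_stalls (Suc (Suc n)) + expectation (\<lambda>\<omega>. u (card (front N \<omega> (Suc (Suc n)))))"
    by (simp add: u_def)
  also have "expectation (\<lambda>\<omega>. u (card (front N \<omega> (Suc (Suc n))))) \<le> expectation (\<lambda>\<omega>. 1)"
    using u by (intro integral_mono integrable_front[of u]) auto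
  finally have 1: "w * (\<Sum>t<Suc (Suc n). expectation (\<lambda>\<omega>. of_bool (card (front N \<omega> t) = N)))
      \<le> mean_stalls (Suc (Suc n)) + 1"
    by (simp add: prob_space)
  have "(1 - real N * (1 - p\<^sup>2) ^ N) * real n = (\<Sum>t<n. 1 - real N * (1 - p\<^sup>2) ^ N)"
    by simp
  also have "\<dots> \<le> (\<Sum>t<n. expectation (\<lambda>\<omega>. of_bool (card (front N \<omega> (Suc (Suc t))) = N)))"
    by (intro sum_mono expectation_front_full)
  \<comment> \<open>The estimate of a full front starts at time 2, so the first two nonnegative
    terms are dropped.\<close>
  also have "\<dots> \<le> (\<Sum>t<Suc (Suc n). expectation (\<lambda>\<omega>. of_bool (card (front N \<omega> t) = N)))"
    by (simp only: sum.lessThan_Suc_shift) (simp add: integral_nonneg del: front.simps)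
  finally have "w * ((1 - real N * (1 - p\<^sup>2) ^ N) * real n)
      \<le> w * (\<Sum>t<Suc (Suc n). expectation (\<lambda>\<omega>. of_bool (card (front N \<omega> t) = N)))"
    using w0 by (rule mult_left_mono)
  with 1 show ?thesis unfolding w_def by (simp add: mult.assoc)
qed

section \<open>The stall rate\<close>

text \<open>Reindexing a product of identical factors along an injective map preserves the measure.
  The map \<open>t\<close> is the time shift cut down to \<open>xi_index N\<close>, so that it lands
  in the product space.\<close>

lemma expectation_stalls_time_shift:
  "expectation (\<lambda>\<omega>. stalls N (time_shift m \<omega>) n) = mean_stalls n"
proof -
  define f :: "nat \<times> nat \<times> nat \<Rightarrow> nat \<times> nat \<times> nat" where "f = (\<lambda>(i, j, s). (i, j, s + m))"
  define t :: "(nat \<times> nat \<times> nat \<Rightarrow> bool) \<Rightarrow> nat \<times> nat \<times> nat \<Rightarrow> bool" where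
    "t = (\<lambda>\<omega>. \<lambda>x\<in>xi_index N. \<omega> (f x))"
  have f: "f \<in> xi_index N \<rightarrow> xi_index N" by (auto simp: f_def xi_index_def)
  have "inj_on f (xi_index N)" by (auto simp: f_def inj_on_def)
  then have distr: "distr \<Xi> \<Xi> t = \<Xi>"
    unfolding t_def xi_space_def using f by (intro distr_PiM_reindex prob_space_measure_pmf)
  have t: "t \<in> measurable \<Xi> \<Xi>"
    unfolding t_def xi_space_def[of p N]
    by (intro measurable_restrict measurable_component_singleton) (use f in auto)
  have "mean_stalls n = (\<integral>\<omega>. stalls N \<omega> n \<partial>distr \<Xi> \<Xi> t)"
    by (simp only: distr mean_stalls_def)
  also have "\<dots> = expectation (\<lambda>\<omega>. stalls N (t \<omega>) n)"
    by (rule integral_distr[OF t stalls_measurable])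
  also have "\<dots> = expectation (\<lambda>\<omega>. stalls N (time_shift m \<omega>) n)"
  proof (intro Bochner_Integration.integral_cong refl stalls_cong)
    fix \<omega> x assume "x \<in> {1..N} \<times> {1..N} \<times> {1..n}"
    then show "t \<omega> x = time_shift m \<omega> x"
      by (auto simp: t_def f_def time_shift_def xi_index_def)
  qed
  finally show ?thesis by simp
qed

lemma stalls_time_shift_dep:
  assumes "\<And>x. x \<in> {1..N} \<times> {1..N} \<times> {Suc m..m + n} \<Longrightarrow> \<omega> x = \<omega>' x"
  shows "stalls N (time_shift m \<omega>) n = stalls N (time_shift m \<omega>') n"
proof (rule stalls_cong)
  fix x assume "x \<in> {1..N} \<times> {1..N} \<times> {1..n}"
  then show "time_shift m \<omega> x = time_shift m \<omega>' x"
    by (cases x) (auto simp: time_shift_def intro!: assms)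
qed

lemma stalls_time_shift_measurable:
  "(\<lambda>\<omega>. stalls N (time_shift m \<omega>) n) \<in> measurable \<Xi> (count_space UNIV)"
proof (rule block_measurable[where K="{1..N} \<times> {1..N} \<times> {Suc m..m + n}"])
  show "stalls N (time_shift m \<omega>) n = stalls N (time_shift m \<omega>') n"
    if "\<And>x. x \<in> {1..N} \<times> {1..N} \<times> {Suc m..m + n} \<Longrightarrow> \<omega> x = \<omega>' x" for \<omega> \<omega>'
    using that by (rule stalls_time_shift_dep)
qed (auto simp: xi_index_def)

lemma mean_stalls_near_additive:
  "\<bar>mean_stalls (m + n) - mean_stalls m - mean_stalls n\<bar> \<le> 1"
proof -
  have int: "integrable \<Xi> (\<lambda>\<omega>. stalls N (time_shift m \<omega>) n)"
    using measurable_compose[OF stalls_time_shift_measurable[of m n], of "\<lambda>x. x" borel]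
    by (intro integrable_const_bound[where B="real n"]) (auto simp: stalls_nonneg stalls_le)
  let ?d = "\<lambda>\<omega>. stalls N \<omega> (m + n) - stalls N \<omega> m - stalls N (time_shift m \<omega>) n"
  have "mean_stalls (m + n) - mean_stalls m - mean_stalls n = expectation ?d"
    unfolding mean_stalls_def expectation_stalls_time_shift[of m n, unfolded mean_stalls_def, symmetric]
    using int integrable_stalls by simp
  moreover have "\<bar>expectation ?d\<bar> \<le> expectation (\<lambda>\<omega>. 1)"
  proof (rule order_trans[OF integral_abs_bound integral_mono])
    show "\<bar>?d \<omega>\<bar> \<le> 1" for \<omega>
      using stalls_near_additive[OF N, of \<omega> m n] by linarith
  qed (use int integrable_stalls in auto)
  ultimately show ?thesis by (simp add: prob_space)
qed

definition stall_rate :: real where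
  "stall_rate = lim (\<lambda>n. mean_stalls n / real n)"

lemma stall_rate: "(\<lambda>n. mean_stalls n / real n) \<longlonglongrightarrow> stall_rate"
  unfolding stall_rate_def
  using near_additive_convergent[of mean_stalls 1] mean_stalls_near_additive
  by (simp add: convergent_LIMSEQ_iff)

section \<open>Concentration and almost sure convergence\<close>

lemma stalls_eq_blocks:
  "\<bar>stalls N \<omega> (b * k) - (\<Sum>l<b. stalls N (time_shift (l * k) \<omega>) k)\<bar> \<le> real b"
proof (induction b)
  case (Suc b)
  then show ?case
    using stalls_near_additive[OF N, of \<omega> "b * k" k]
    by (simp add: add.commute[of k])
qed simp

text \<open>Hoeffding for \<open>k\<close> independent variables in \<open>[0, k]\<close>: the
  exponent is \<open>2 * (\<epsilon> * k\<^sup>2)\<^sup>2 / k ^ 3\<close>, linear in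
  \<open>k\<close>, so the bounds are summable.\<close>

lemma prob_stalls_blocks_deviation:
  assumes "0 < \<epsilon>" "1 \<le> k"
  shows "prob {\<omega> \<in> space \<Xi>. \<epsilon> * real (k * k) \<le>
      \<bar>(\<Sum>l<k. stalls N (time_shift (l * k) \<omega>) k) - real k * mean_stalls k\<bar>}
    \<le> 2 * exp (- 2 * \<epsilon>\<^sup>2) ^ k"
proof -
  let ?X = "\<lambda>l \<omega>. stalls N (time_shift (l * k) \<omega>) k"
  have "indep_vars (\<lambda>_. count_space UNIV) ?X {..<k}"
  proof (rule indep_vars_blocks[where K="\<lambda>l. {1..N} \<times> {1..N} \<times> {Suc (l * k)..l * k + k}"])
    show "disjoint_family_on (\<lambda>l. {1..N} \<times> {1..N} \<times> {Suc (l * k)..l * k + k}) {..<k}"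
      unfolding disjoint_family_on_def
    proof (intro ballI impI)
      fix l l' :: nat assume "l \<noteq> l'"
      then consider "l + 1 \<le> l'" | "l' + 1 \<le> l" by linarith
      then have "l * k + k \<le> l' * k \<or> l' * k + k \<le> l * k"
      proof cases
        case 1 from mult_le_mono1[OF this, of k] show ?thesis by (simp add: algebra_simps)
      next
        case 2 from mult_le_mono1[OF this, of k] show ?thesis by (simp add: algebra_simps)
      qed
      then show "({1..N} \<times> {1..N} \<times> {Suc (l * k)..l * k + k})
          \<inter> ({1..N} \<times> {1..N} \<times> {Suc (l' * k)..l' * k + k}) = {}"
        by auto
    qed
    show "?X l \<omega> = ?X l \<omega>'"
      if "\<And>x. x \<in> {1..N} \<times> {1..N} \<times> {Suc (l * k)..l * k + k} \<Longrightarrow> \<omega> x = \<omega>' x" for l \<omega> \<omega>'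
      using that by (rule stalls_time_shift_dep)
  qed (auto simp: xi_index_def)
  then have indep: "indep_vars (\<lambda>_. borel) ?X {..<k}"
    by (rule indep_vars_compose2[where Y="\<lambda>_ x. x"]) simp
  interpret Hoeffding_ineq \<Xi> "{..<k}" ?X "\<lambda>_. 0" "\<lambda>_. real k" "\<Sum>l<k. expectation (?X l)"
    by unfold_locales (use indep in \<open>auto simp: stalls_nonneg stalls_le\<close>)
  have "prob {\<omega> \<in> space \<Xi>. \<epsilon> * real (k * k) \<le> \<bar>(\<Sum>l<k. ?X l \<omega>) - (\<Sum>l<k. expectation (?X l))\<bar>}
      \<le> 2 * exp (- 2 * (\<epsilon> * real (k * k))\<^sup>2 / (\<Sum>l<k. (real k - 0)\<^sup>2))"
    using assms by (intro Hoeffding_ineq_abs_ge) auto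
  also have "- 2 * (\<epsilon> * real (k * k))\<^sup>2 / (\<Sum>l<k. (real k - 0)\<^sup>2) = real k * (- 2 * \<epsilon>\<^sup>2)"
    using assms by (simp add: field_simps power2_eq_square)
  also have "exp (real k * (- 2 * \<epsilon>\<^sup>2)) = exp (- 2 * \<epsilon>\<^sup>2) ^ k"
    by (rule exp_of_nat_mult)
  finally show ?thesis
    by (simp add: expectation_stalls_time_shift)
qed

lemma AE_eventually_blocks_close:
  assumes "0 < \<epsilon>"
  shows "AE \<omega> in \<Xi>. \<forall>\<^sub>F k in sequentially.
    \<bar>(\<Sum>l<k. stalls N (time_shift (l * k) \<omega>) k) - real k * mean_stalls k\<bar> < \<epsilon> * real (k * k)"
proof -
  define A where "A = (\<lambda>k. {\<omega> \<in> space \<Xi>. \<epsilon> * real (k * k) \<le>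
      \<bar>(\<Sum>l<k. stalls N (time_shift (l * k) \<omega>) k) - real k * mean_stalls k\<bar>})"
  have "AE \<omega> in \<Xi>. \<forall>\<^sub>F k in sequentially. \<omega> \<in> space \<Xi> - A k"
  proof (rule borel_cantelli_AE1)
    have [measurable]: "(\<lambda>\<omega>. stalls N (time_shift m \<omega>) n) \<in> borel_measurable \<Xi>" for m n
      using measurable_compose[OF stalls_time_shift_measurable[of m n], of "\<lambda>x. x" borel] by simp
    show "A k \<in> events" for k unfolding A_def by measurable
    show "emeasure \<Xi> (A k) < \<infinity>" for k by (simp add: emeasure_eq_measure)
    have "summable (\<lambda>k. 2 * exp (- 2 * \<epsilon>\<^sup>2) ^ k)"
      using assms by (intro summable_mult summable_geometric) simp
    then show "summable (\<lambda>k. prob (A k))"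
      by (rule summable_comparison_test'[where N=1])
         (use prob_stalls_blocks_deviation[OF assms] in \<open>simp add: A_def\<close>)
  qed
  then show ?thesis
    by (rule AE_mp) (auto simp: A_def not_le intro!: AE_I2 elim!: eventually_mono)
qed

text \<open>The limit is first taken along squares, with countably many tolerances
  \<open>inverse (Suc r)\<close> sharing one null set; \<open>tendsto_div_of_squares\<close> fills
  the gaps.\<close>

lemma AE_stalls_tendsto: "AE \<omega> in \<Xi>. (\<lambda>n. stalls N \<omega> n / real n) \<longlonglongrightarrow> stall_rate"
proof -
  have "AE \<omega> in \<Xi>. \<forall>r. \<forall>\<^sub>F k in sequentially.
    \<bar>(\<Sum>l<k. stalls N (time_shift (l * k) \<omega>) k) - real k * mean_stalls k\<bar>
      < inverse (real (Suc r)) * real (k * k)"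
    unfolding AE_all_countable by (intro allI AE_eventually_blocks_close) simp
  then show ?thesis
  proof (rule AE_mp, intro AE_I2 impI)
    fix \<omega>
    assume close: "\<forall>r. \<forall>\<^sub>F k in sequentially.
      \<bar>(\<Sum>l<k. stalls N (time_shift (l * k) \<omega>) k) - real k * mean_stalls k\<bar>
        < inverse (real (Suc r)) * real (k * k)"
    have "(\<lambda>k. stalls N \<omega> (k * k) / real (k * k) - mean_stalls k / real k) \<longlonglongrightarrow> 0"
    proof (rule tendstoI)
      fix e :: real assume "0 < e"
      then obtain r where r: "inverse (real (Suc r)) < e / 2"
        using reals_Archimedean[of "e / 2"] by auto
      \<comment> \<open>Beyond \<open>k0\<close> the \<open>k\<close> junction errors are at most
        \<open>e / 2 * (k * k)\<close>; the other half of \<open>e\<close> is for the deviation of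
        the window sum from its mean.\<close>
      obtain k0 :: nat where k0: "2 / e < real k0" using reals_Archimedean2 by blast
      from close have "\<forall>\<^sub>F k in sequentially.
          \<bar>(\<Sum>l<k. stalls N (time_shift (l * k) \<omega>) k) - real k * mean_stalls k\<bar>
          < inverse (real (Suc r)) * real (k * k)" by blast
      then show "\<forall>\<^sub>F k in sequentially.
          dist (stalls N \<omega> (k * k) / real (k * k) - mean_stalls k / real k) 0 < e"
        using eventually_ge_at_top[of "max 1 k0"]
      proof eventually_elim
        case (elim k)
        have k: "1 \<le> k" "real k0 \<le> real k" using elim by auto
        have "2 / e < real k" using k0 k(2) by linarith
        then have "2 < e * real k" using \<open>0 < e\<close> by (simp add: field_simps)
        then have "1 * real k \<le> e / 2 * real k * real k"
          by (intro mult_right_mono) auto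
        then have small: "real k \<le> e / 2 * real (k * k)" by (simp add: mult.assoc)
        have "inverse (real (Suc r)) * real (k * k) \<le> e / 2 * real (k * k)"
          using r by (intro mult_right_mono) auto
        then have "\<bar>stalls N \<omega> (k * k) - real k * mean_stalls k\<bar> < e * real (k * k)"
          using elim(1) stalls_eq_blocks[of \<omega> k k] small by linarith
        moreover have "stalls N \<omega> (k * k) / real (k * k) - mean_stalls k / real k
            = (stalls N \<omega> (k * k) - real k * mean_stalls k) / real (k * k)"
          using k by (simp add: field_simps)
        ultimately show ?case
          using k by (simp add: abs_divide divide_less_eq)
      qed
    qed
    from tendsto_add[OF this stall_rate]
    have "(\<lambda>k. stalls N \<omega> (k * k) / real (k * k)) \<longlonglongrightarrow> stall_rate" by simp
    then show "(\<lambda>n. stalls N \<omega> n / real n) \<longlonglongrightarrow> stall_rate"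
      by (intro tendsto_div_of_squares[where s="stalls N \<omega>"] stalls_mono stalls_add_le)
  qed
qed

lemma AE_Max_Xproc_tendsto:
  "AE \<omega> in \<Xi>. (\<lambda>t. Max ((\<lambda>i. Xproc N X0 \<omega> t i) ` {1..N}) / real t) \<longlonglongrightarrow> 1 - stall_rate"
proof -
  obtain C where C: "\<bar>Max ((\<lambda>i. Xproc N X0 \<omega> t i) ` {1..N}) - (real t - stalls N \<omega> t)\<bar> \<le> C" for \<omega> t
    using Max_Xproc_bounds[OF N, of X0] by blast
  from AE_stalls_tendsto show ?thesis
  proof (rule AE_mp, intro AE_I2 impI)
    fix \<omega> assume lim: "(\<lambda>n. stalls N \<omega> n / real n) \<longlonglongrightarrow> stall_rate"
    let ?M = "\<lambda>t. Max ((\<lambda>i. Xproc N X0 \<omega> t i) ` {1..N})"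
    have "(\<lambda>t. (?M t - (real t - stalls N \<omega> t)) / real t) \<longlonglongrightarrow> 0"
    proof (rule Lim_null_comparison[OF _ lim_const_over_n])
      show "\<forall>\<^sub>F t in sequentially. norm ((?M t - (real t - stalls N \<omega> t)) / real t) \<le> C / real t"
        using C by (intro always_eventually allI) (simp add: divide_right_mono)
    qed
    from tendsto_add[OF this tendsto_diff[OF tendsto_const[of 1] lim]]
    have "(\<lambda>t. (?M t - (real t - stalls N \<omega> t)) / real t + (1 - stalls N \<omega> t / real t))
        \<longlonglongrightarrow> 1 - stall_rate" by simp
    then show "(\<lambda>t. ?M t / real t) \<longlonglongrightarrow> 1 - stall_rate"
    proof (rule Lim_transform_eventually)
      show "\<forall>\<^sub>F t in sequentially. (?M t - (real t - stalls N \<omega> t)) / real t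
          + (1 - stalls N \<omega> t / real t) = ?M t / real t"
        using eventually_ge_at_top[of 1] by eventually_elim (simp add: field_simps)
    qed
  qed
qed

lemma stall_rate_le:
  assumes "\<And>j. 1 \<le> j \<Longrightarrow>
    (\<Sum>m=1..<N. real (N choose m) * (q ^ j) ^ m * (1 + 2 * excess q N (N - m))) \<le> 2 * excess q N j"
  shows "stall_rate \<le>
    q ^ (N * N) * (2 ^ N + 2 * (\<Sum>m=1..<N. real (N choose m) * excess q N (N - m)))"
proof (rule tendsto_upperbound[OF stall_rate])
  let ?w = "q ^ (N * N) * (2 ^ N + 2 * (\<Sum>m=1..<N. real (N choose m) * excess q N (N - m)))"
  show "\<forall>\<^sub>F n in sequentially. mean_stalls n / real n \<le> ?w"
    using eventually_ge_at_top[of 1]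
  proof eventually_elim
    case (elim n)
    then show ?case using mean_stalls_le[OF assms, of n] by (simp add: divide_le_eq mult.commute)
  qed
qed simp

lemma stall_rate_ge:
  "q ^ (N * N) * ((2 - q ^ N) ^ N - 1) * (1 - real N * (1 - p\<^sup>2) ^ N) \<le> stall_rate"
proof (rule LIMSEQ_le)
  let ?w = "q ^ (N * N) * ((2 - q ^ N) ^ N - 1) * (1 - real N * (1 - p\<^sup>2) ^ N)"
  \<comment> \<open>The numerator collects the two missing time steps and the \<open>- 1\<close> of
    \<open>mean_stalls_ge\<close>.\<close>
  have "(\<lambda>n. ?w - (2 * ?w + 1) / real n) \<longlonglongrightarrow> ?w - 0"
    by (intro tendsto_diff tendsto_const lim_const_over_n)
  then show "(\<lambda>n. ?w - (2 * ?w + 1) / real n) \<longlonglongrightarrow> ?w" by simp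
  show "(\<lambda>n. mean_stalls n / real n) \<longlonglongrightarrow> stall_rate" by (rule stall_rate)
  show "\<exists>n0. \<forall>n\<ge>n0. ?w - (2 * ?w + 1) / real n \<le> mean_stalls n / real n"
  proof (intro exI allI impI)
    fix n :: nat assume n: "2 \<le> n"
    then obtain k where k: "n = Suc (Suc k)" by (metis Suc_le_D numeral_2_eq_2 Suc_le_mono)
    have "?w - (2 * ?w + 1) / real n = (?w * real k - 1) / real n"
      using k by (simp add: field_simps)
    also have "\<dots> \<le> mean_stalls n / real n"
      using mean_stalls_ge[of k] unfolding k by (intro divide_right_mono) auto
    finally show "?w - (2 * ?w + 1) / real n \<le> mean_stalls n / real n" .
  qed
qed

end

section \<open>Asymptotics of the stall rate in \<open>N\<close>\<close>

theorem theorem5p1: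
  fixes p q :: real
  assumes "0 < p" "p < 1" "q = 1 - p"
  shows "\<exists>v :: nat \<Rightarrow> real.
     (\<forall>N \<ge> 1. \<forall>X0 :: nat \<Rightarrow> real.
        AE \<omega> in xi_space p N.
          (\<lambda>t. Max ((\<lambda>i. Xproc N X0 \<omega> t i) ` {1..N}) / real t) \<longlonglongrightarrow> v N)
   \<and> (\<lambda>N. v N - (1 - q ^ (N^2) * 2 ^ N)) \<in> o(\<lambda>N. q ^ (N^2) * 2 ^ N)"
proof (intro exI conjI allI impI)
  \<comment> \<open>Outside the locale \<open>stall_rate\<close> takes only \<open>p\<close> and
    \<open>N\<close>, so \<open>f\<close> is a function of \<open>N\<close>.\<close>
  define f where "f = max_plus_bernoulli.stall_rate p"
  have mpb: "max_plus_bernoulli p q N" if "1 \<le> N" for N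
    using assms that by unfold_locales
  have q: "0 < q" "q < 1" using assms by auto
  show "AE \<omega> in xi_space p N.
      (\<lambda>t. Max ((\<lambda>i. Xproc N X0 \<omega> t i) ` {1..N}) / real t) \<longlonglongrightarrow> 1 - f N"
    if "1 \<le> N" for N and X0 :: "nat \<Rightarrow> real"
    unfolding f_def by (rule max_plus_bernoulli.AE_Max_Xproc_tendsto[OF mpb[OF that]])
  let ?g = "\<lambda>N. q ^ (N * N) * 2 ^ N"
  let ?D = "\<lambda>N. \<Sum>m=1..<N. real (N choose m) * excess q N (N - m)"
  have geo: "(\<lambda>N. real N * x ^ N) \<longlonglongrightarrow> 0" if "0 \<le> x" "x < 1" for x :: real
    using powser_times_n_limit_0[of x] that by simp
  have "(\<lambda>N. f N / ?g N) \<longlonglongrightarrow> 1"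
  proof (rule tendsto_sandwich)
    \<comment> \<open>After division by \<open>2 ^ N\<close>, Bernoulli's inequality for
      \<open>(1 - q ^ N / 2) ^ N\<close> gives the first two terms, and the \<open>- 1\<close> in
      \<open>stall_rate_ge\<close> becomes \<open>(1 / 2) ^ N\<close>.\<close>
    let ?l = "\<lambda>N. (1 - real N * q ^ N / 2 - (1 / 2) ^ N) * (1 - real N * (1 - p\<^sup>2) ^ N)"
    have "0 \<le> 1 - p\<^sup>2" "1 - p\<^sup>2 < 1"
      using assms by (auto simp: power_le_one)
    moreover have "(\<lambda>N. (1 / 2 :: real) ^ N) \<longlonglongrightarrow> 0" by (rule LIMSEQ_realpow_zero) auto
    ultimately have "?l \<longlonglongrightarrow> (1 - 0 / 2 - 0) * (1 - 0)"
      using q by (intro tendsto_intros geo) auto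
    then show "?l \<longlonglongrightarrow> 1" by simp
    \<comment> \<open>For small \<open>N\<close> the second factor of \<open>?l\<close> may be
      negative; multiplying an inequality by it needs its sign.\<close>
    have "\<forall>\<^sub>F N in sequentially. real N * (1 - p\<^sup>2) ^ N < 1"
      using order_tendstoD(2)[OF geo[of "1 - p\<^sup>2"], of 1] \<open>0 \<le> 1 - p\<^sup>2\<close> \<open>1 - p\<^sup>2 < 1\<close> by simp
    then show "\<forall>\<^sub>F N in sequentially. ?l N \<le> f N / ?g N"
      using eventually_ge_at_top[of 1]
    proof eventually_elim
      case (elim N)
      have "1 - real N * q ^ N / 2 \<le> (1 - q ^ N / 2) ^ N"
        using Bernoulli_inequality[of "- (q ^ N / 2)" N] power_le_one[of q N] q by simp
      also have "\<dots> = (2 - q ^ N) ^ N / 2 ^ N"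
        by (simp add: power_divide[symmetric] diff_divide_distrib)
      finally have "1 - real N * q ^ N / 2 - (1 / 2) ^ N \<le> ((2 - q ^ N) ^ N - 1) / 2 ^ N"
        by (simp add: diff_divide_distrib power_one_over)
      then have "?l N \<le> ((2 - q ^ N) ^ N - 1) / 2 ^ N * (1 - real N * (1 - p\<^sup>2) ^ N)"
        using elim by (intro mult_right_mono) auto
      also have "\<dots> = q ^ (N * N) * ((2 - q ^ N) ^ N - 1) * (1 - real N * (1 - p\<^sup>2) ^ N) / ?g N"
        using q by simp
      also have "\<dots> \<le> f N / ?g N"
        unfolding f_def using q
        by (intro divide_right_mono max_plus_bernoulli.stall_rate_ge mpb elim) auto
      finally show ?case .
    qed
    show "(\<lambda>N. 1 + 2 * (?D N / 2 ^ N)) \<longlonglongrightarrow> 1"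
      using tendsto_add[OF tendsto_const[of 1] tendsto_mult[OF tendsto_const[of 2]
        sum_choose_excess_tendsto_0[OF q]]] by simp
    show "\<forall>\<^sub>F N in sequentially. f N / ?g N \<le> 1 + 2 * (?D N / 2 ^ N)"
      using eventually_sum_choose_excess_le[OF q] eventually_ge_at_top[of 1]
    proof eventually_elim
      case (elim N)
      have "f N \<le> q ^ (N * N) * (2 ^ N + 2 * ?D N)"
        unfolding f_def
        by (rule max_plus_bernoulli.stall_rate_le[OF mpb[OF elim(2)]]) (use elim(1) in blast)
      then have "f N / ?g N \<le> q ^ (N * N) * (2 ^ N + 2 * ?D N) / ?g N"
        using q by (intro divide_right_mono) auto
      also have "\<dots> = 1 + 2 * (?D N / 2 ^ N)"
        using q by (simp add: add_divide_distrib)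
      finally show ?case .
    qed
  qed
  then have "(\<lambda>N. 1 - f N / ?g N) \<longlonglongrightarrow> 1 - 1"
    by (intro tendsto_diff tendsto_const)
  then show "(\<lambda>N. 1 - f N - (1 - q ^ (N^2) * 2 ^ N)) \<in> o(\<lambda>N. q ^ (N^2) * 2 ^ N)"
    using q by (intro smalloI_tendsto) (simp_all add: power2_eq_square diff_divide_distrib)
qed

end
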